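(* Let $G$ be a unimodular locally compact (Hausdorff) group with Haar measure $m$, and let $\nu$ be a locally finite (positive Borel) measure on $G$. Then \[ B^-_\nu\le \mathrm{L}^-_\nu\le B^-_\nu \cdot I(G), \qquad I(G)^{-1} \cdot B^+_\nu \le \mathrm{L}^+_\nu \le B^+_\nu . \] In particular, if $G$ is additionally amenable, then $B^-_\nu=\mathrm{L}^-_\nu\le \mathrm{L}^+_\nu= B^+_\nu$.
   Context: A measure means a positive Borel measure; it is locally finite if it is finite on compact sets. Let $\mathcal K$ be the collection of nonempty compact subsets of $G$ and $\mathcal K_p\subseteq\mathcal K$ those of positive Haar measure. For $A,B\subseteq G$, $AB=\{ab: a\in A, b\in B\}$. Leptin's invariant: $I(G)=\sup_{K\in \mathcal K}\inf_{A\in \mathcal K_p} m(KA)/m(A)\in[1,\infty]$. Lower and upper Leptin densities: $\mathrm{L}_\nu^-=\sup_{K\in \mathcal K}\inf_{A\in \mathcal K_p} \nu(KA)/m(A)$, $\mathrm{L}_\nu^+=\inf_{K\in \mathcal K}\sup_{A\in \mathcal K_p} \nu(A)/m(KA)$. Lower and upper Beurling densities: $B^-_\nu=\sup_{A\in\mathcal K_p} \inf_{s\in G} \nu(As)/m(A)$, $B^+_\nu=\inf_{A\in \mathcal K_p}\sup_{s\in G} \nu(As)/m(A)$. Arithmetic is in $[0,\infty]$ with $1/\infty=0$ and $0\cdot\infty=0$. $G$ is amenable if it admits a left-invariant mean on $L^\infty(G)$. *)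

theory Defs
  imports "HOL-Analysis.Analysis"
begin

definition topological_group ::
  "('a::topological_space \<Rightarrow> 'a \<Rightarrow> 'a) \<Rightarrow> 'a \<Rightarrow> ('a \<Rightarrow> 'a) \<Rightarrow> bool" where
  "topological_group mul e iv \<longleftrightarrow>
     (\<forall>x y z. mul (mul x y) z = mul x (mul y z)) \<and>
     (\<forall>x. mul e x = x \<and> mul x e = x) \<and>
     (\<forall>x. mul (iv x) x = e \<and> mul x (iv x) = e) \<and>
     continuous_on UNIV (\<lambda>p. mul (fst p) (snd p)) \<and>
     continuous_on UNIV iv"

definition lc_group ::
  "('a::t2_space \<Rightarrow> 'a \<Rightarrow> 'a) \<Rightarrow> 'a \<Rightarrow> ('a \<Rightarrow> 'a) \<Rightarrow> bool" where
  "lc_group mul e iv \<longleftrightarrow> topological_group mul e iv \<and> locally compact (UNIV :: 'a set)"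

definition left_haar_measure ::
  "('a::t2_space \<Rightarrow> 'a \<Rightarrow> 'a) \<Rightarrow> 'a measure \<Rightarrow> bool" where
  "left_haar_measure mul m \<longleftrightarrow>
     sets m = sets borel \<and>
     (\<forall>K. compact K \<longrightarrow> emeasure m K < \<infinity>) \<and>
     (\<forall>U. open U \<and> U \<noteq> {} \<longrightarrow> emeasure m U > 0) \<and>
     (\<forall>A \<in> sets borel. \<forall>s. emeasure m ((\<lambda>x. mul s x) ` A) = emeasure m A) \<and>
     (\<forall>A \<in> sets borel. emeasure m A = (INF U \<in> {U. open U \<and> A \<subseteq> U}. emeasure m U)) \<and>
     (\<forall>U. open U \<longrightarrow> emeasure m U = (SUP K \<in> {K. compact K \<and> K \<subseteq> U}. emeasure m K))"

definition unimodular_haar ::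
  "('a::t2_space \<Rightarrow> 'a \<Rightarrow> 'a) \<Rightarrow> 'a measure \<Rightarrow> bool" where
  "unimodular_haar mul m \<longleftrightarrow> left_haar_measure mul m \<and>
     (\<forall>A \<in> sets borel. \<forall>s. emeasure m ((\<lambda>x. mul x s) ` A) = emeasure m A)"

definition locally_finite_measure :: "'a::t2_space measure \<Rightarrow> bool" where
  "locally_finite_measure \<nu> \<longleftrightarrow> sets \<nu> = sets borel \<and>
     (\<forall>K. compact K \<longrightarrow> emeasure \<nu> K < \<infinity>)"

definition setmul :: "('a \<Rightarrow> 'a \<Rightarrow> 'a) \<Rightarrow> 'a set \<Rightarrow> 'a set \<Rightarrow> 'a set" where
  "setmul mul A B = {mul a b | a b. a \<in> A \<and> b \<in> B}"

definition cpt_sets :: "'a::topological_space set set" where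
  "cpt_sets = {K. compact K \<and> K \<noteq> {}}"

definition cpt_pos_sets :: "'a::topological_space measure \<Rightarrow> 'a set set" where
  "cpt_pos_sets m = {A \<in> cpt_sets. emeasure m A > 0}"

definition leptin_invariant ::
  "('a::topological_space \<Rightarrow> 'a \<Rightarrow> 'a) \<Rightarrow> 'a measure \<Rightarrow> ennreal" where
  "leptin_invariant mul m =
     (SUP K \<in> cpt_sets. INF A \<in> cpt_pos_sets m. emeasure m (setmul mul K A) / emeasure m A)"

definition lower_leptin_density ::
  "('a::topological_space \<Rightarrow> 'a \<Rightarrow> 'a) \<Rightarrow> 'a measure \<Rightarrow> 'a measure \<Rightarrow> ennreal" where
  "lower_leptin_density mul m \<nu> =
     (SUP K \<in> cpt_sets. INF A \<in> cpt_pos_sets m. emeasure \<nu> (setmul mul K A) / emeasure m A)"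

definition upper_leptin_density ::
  "('a::topological_space \<Rightarrow> 'a \<Rightarrow> 'a) \<Rightarrow> 'a measure \<Rightarrow> 'a measure \<Rightarrow> ennreal" where
  "upper_leptin_density mul m \<nu> =
     (INF K \<in> cpt_sets. SUP A \<in> cpt_pos_sets m. emeasure \<nu> A / emeasure m (setmul mul K A))"

definition lower_beurling_density ::
  "('a::topological_space \<Rightarrow> 'a \<Rightarrow> 'a) \<Rightarrow> 'a measure \<Rightarrow> 'a measure \<Rightarrow> ennreal" where
  "lower_beurling_density mul m \<nu> =
     (SUP A \<in> cpt_pos_sets m. INF s. emeasure \<nu> ((\<lambda>x. mul x s) ` A) / emeasure m A)"

definition upper_beurling_density ::
  "('a::topological_space \<Rightarrow> 'a \<Rightarrow> 'a) \<Rightarrow> 'a measure \<Rightarrow> 'a measure \<Rightarrow> ennreal" where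
  "upper_beurling_density mul m \<nu> =
     (INF A \<in> cpt_pos_sets m. SUP s. emeasure \<nu> ((\<lambda>x. mul x s) ` A) / emeasure m A)"

text \<open>Amenability: existence of a left-invariant mean on L^\<infinity>(G) (essentially
  bounded Borel functions; the conditions make M respect a.e. equality).\<close>
definition Linf :: "'a measure \<Rightarrow> ('a \<Rightarrow> real) set" where
  "Linf m = {f. f \<in> borel_measurable m \<and> (\<exists>C. AE x in m. \<bar>f x\<bar> \<le> C)}"

definition amenable_group ::
  "('a \<Rightarrow> 'a \<Rightarrow> 'a) \<Rightarrow> 'a measure \<Rightarrow> bool" where
  "amenable_group mul m \<longleftrightarrow> (\<exists>M :: ('a \<Rightarrow> real) \<Rightarrow> real.
     (\<forall>f \<in> Linf m. \<forall>g \<in> Linf m. M (\<lambda>x. f x + g x) = M f + M g) \<and>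
     (\<forall>f \<in> Linf m. \<forall>c. M (\<lambda>x. c * f x) = c * M f) \<and>
     (\<forall>f \<in> Linf m. (AE x in m. 0 \<le> f x) \<longrightarrow> 0 \<le> M f) \<and>
     M (\<lambda>x. 1) = 1 \<and>
     (\<forall>f \<in> Linf m. \<forall>s. M (\<lambda>x. f (mul s x)) = M f))"

end

theory Submission
  imports Defs
begin

text \<open>
  All inequalities come from double counting: for compact \<open>A\<close>, \<open>F\<close>, both \<open>\<integral>\<^sub>F \<nu>(As) dm(s)\<close> and
  \<open>\<integral>\<^sub>F m(A\<inverse>x) d\<nu>(x)\<close> compare \<open>\<nu>\<close> with \<open>m\<close>, and \<open>m(A\<inverse>x) = m(A)\<close> by unimodularity. The integrals
  over \<open>s\<close> are replaced by Riemann sums over small Borel cells, because neither \<open>\<sigma>\<close>-finiteness of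
  \<open>m\<close> nor regularity of \<open>\<nu>\<close> is available. The bounds involving \<open>I(G)\<close> only use a test set \<open>KA\<close>
  with \<open>m(KA)/m(A)\<close> close to the infimum.

  If \<open>G\<close> is amenable, then \<open>I(G) = 1\<close>: Hahn-Banach and the invariant mean produce, for every \<open>\<theta>\<close> in
  \<open>C\<^sub>c(G)\<close> of integral zero, convex combinations of right translates of \<open>\<theta>\<close> that are small in
  \<open>L\<^sup>1\<close>. Applied to finitely many \<open>\<phi>(k\<inverse>x) - \<phi>(x)\<close> this gives \<open>f \<ge> 0\<close> with
  \<open>\<integral> sup\<^bsub>k\<in>K\<^esub> f(k\<inverse>x) dm(x) \<le> (1 + \<epsilon>) \<integral> f dm\<close>, and a level set \<open>A\<close> of \<open>f\<close> satisfies
  \<open>m(KA) \<le> (1 + \<epsilon>) m(A)\<close>.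
\<close>

section \<open>Topology of the group\<close>

text \<open>The two comparisons with the Beurling densities are not mirror images. A Riemann sum
  needs room for \<open>s\<close> to move within a cell. In the lower comparison the room is taken
  on the side of \<open>m\<close>, where outer regularity absorbs it; in the upper one it enlarges
  the translate \<open>A \<star> {s}\<close> measured by \<nu>, which forces a limit of nearly
  optimal translates. The hypotheses on \<open>m\<close> give left and right invariance only; that a
  compact set and its inverse have equal measure comes from the lower estimate itself. In the
  amenable part the mean is left invariant while the averages act from the right: if
  \<open>f\<close> is translated on the right, a functional of its right translates, viewed as a
  function of the translating element, is translated on the left. Averaging on the right keeps the
  left translates by \<open>K\<close> under control, because the two actions commute. The inequality
  between the two Leptin densities tests I(G) at the product \<open>L \<star> K\<close> of the two
  competing compact sets.\<close>

locale unimodular_lc_group =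
  fixes mul :: "'a::t2_space \<Rightarrow> 'a \<Rightarrow> 'a" (infixl "\<cdot>" 70)
    and e :: 'a and iv :: "'a \<Rightarrow> 'a" and m :: "'a measure"
  assumes lc: "lc_group mul e iv"
    and unimodular: "unimodular_haar mul m"
begin

abbreviation smul (infixl "\<star>" 75)
  where "A \<star> B \<equiv> setmul mul A B"

sublocale group mul e iv
  using lc by unfold_locales (auto simp: lc_group_def topological_group_def)

lemma iv_mult_cancel [simp]: "iv a \<cdot> (a \<cdot> x) = x" "a \<cdot> (iv a \<cdot> x) = x"
  by (simp_all flip: assoc)

lemma mult_continuous [continuous_intros]:
  assumes "continuous_on S f" "continuous_on S g"
  shows "continuous_on S (\<lambda>x. f x \<cdot> g x)"
proof -
  have "continuous_on UNIV (\<lambda>p. fst p \<cdot> snd p)"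
    using lc by (auto simp: lc_group_def topological_group_def)
  from continuous_on_compose2[OF this continuous_on_Pair[OF assms]] show ?thesis by simp
qed

lemma iv_continuous [continuous_intros]:
  assumes "continuous_on S f"
  shows "continuous_on S (\<lambda>x. iv (f x))"
proof -
  have "continuous_on UNIV iv"
    using lc by (auto simp: lc_group_def topological_group_def)
  from continuous_on_compose2[OF this assms] show ?thesis by simp
qed

section \<open>Products, translates and inverses of sets\<close>

lemma setmulI [intro]: "a \<in> A \<Longrightarrow> b \<in> B \<Longrightarrow> a \<cdot> b \<in> A \<star> B"
  by (auto simp: setmul_def)

lemma setmul_image: "A \<star> B = (\<lambda>p. fst p \<cdot> snd p) ` (A \<times> B)"
  by (force simp: setmul_def)

lemma setmul_assoc: "A \<star> B \<star> C = A \<star> (B \<star> C)"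
proof
  show "A \<star> B \<star> C \<subseteq> A \<star> (B \<star> C)"
    unfolding setmul_def by (auto simp: assoc) blast
  show "A \<star> (B \<star> C) \<subseteq> A \<star> B \<star> C"
    unfolding setmul_def by (auto simp flip: assoc) blast
qed

lemma setmul_mono: "A \<subseteq> A' \<Longrightarrow> B \<subseteq> B' \<Longrightarrow> A \<star> B \<subseteq> A' \<star> B'"
  by (auto simp: setmul_def)

lemma mem_rtrans: "x \<in> A \<star> {s} \<longleftrightarrow> x \<cdot> iv s \<in> A"
proof
  assume "x \<cdot> iv s \<in> A"
  then have "x \<cdot> iv s \<cdot> s \<in> A \<star> {s}" by blast
  then show "x \<in> A \<star> {s}" by (simp add: assoc)
qed (auto simp: setmul_def assoc)

lemma mem_ltrans: "x \<in> {s} \<star> A \<longleftrightarrow> iv s \<cdot> x \<in> A"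
proof
  assume "iv s \<cdot> x \<in> A"
  then have "s \<cdot> (iv s \<cdot> x) \<in> {s} \<star> A" by blast
  then show "x \<in> {s} \<star> A" by simp
qed (auto simp: setmul_def)

lemma rtrans_image: "(\<lambda>x. x \<cdot> s) ` A = A \<star> {s}"
  by (auto simp: setmul_def)

lemma ltrans_image: "(\<lambda>x. s \<cdot> x) ` A = {s} \<star> A"
  by (auto simp: setmul_def)

lemma mem_iv_image: "x \<in> iv ` A \<longleftrightarrow> iv x \<in> A"
  by (metis image_iff inverse_inverse)

lemma iv_image_iv [simp]: "iv ` iv ` A = A"
  by (auto simp: mem_iv_image)

lemma compact_setmul: "compact A \<Longrightarrow> compact B \<Longrightarrow> compact (A \<star> B)"
  unfolding setmul_image
  by (intro compact_continuous_image compact_Times continuous_intros)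

lemma compact_iv: "compact A \<Longrightarrow> compact (iv ` A)"
  by (intro compact_continuous_image continuous_intros)

lemma open_iv: assumes "open U" shows "open (iv ` U)"
proof -
  have "iv ` U = iv -` U" by (auto simp: mem_iv_image)
  then show ?thesis
    using assms by (simp add: open_vimage continuous_on_id iv_continuous)
qed

lemma open_rtrans: assumes "open U" shows "open (U \<star> {s})"
proof -
  have "U \<star> {s} = (\<lambda>x. x \<cdot> iv s) -` U" by (auto simp: mem_rtrans)
  then show ?thesis
    using assms by (auto intro!: open_vimage continuous_intros)
qed

lemma open_ltrans: assumes "open U" shows "open ({s} \<star> U)"
proof -
  have "{s} \<star> U = (\<lambda>x. iv s \<cdot> x) -` U" by (auto simp: mem_ltrans)
  then show ?thesis
    using assms by (auto intro!: open_vimage continuous_intros)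
qed

lemma borel_rtrans [measurable]: assumes "A \<in> sets borel" shows "A \<star> {s} \<in> sets borel"
proof -
  have "(\<lambda>x. x \<cdot> iv s) \<in> borel_measurable borel"
    by (intro borel_measurable_continuous_onI continuous_intros)
  from measurable_sets[OF this assms] show ?thesis
    by (simp add: vimage_def mem_rtrans[symmetric])
qed

section \<open>Neighbourhoods of the identity\<close>

lemma tube:
  assumes "compact A" "open U" "A \<subseteq> U"
  obtains V where "open V" "e \<in> V" "A \<star> V \<subseteq> U" "V \<star> A \<subseteq> U"
proof -
  let ?P = "(\<lambda>p. snd p \<cdot> fst p) -` U" and ?Q = "(\<lambda>p. fst p \<cdot> snd p) -` U"
  have o: "open ?P" "open ?Q"
    by (auto intro!: open_vimage continuous_intros \<open>open U\<close>)
  have s: "{e} \<times> A \<subseteq> ?P" "{e} \<times> A \<subseteq> ?Q"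
    using assms(3) by auto
  obtain V where V: "e \<in> V" "open V" "V \<times> A \<subseteq> ?P"
    using Elementary_Topology.tube_lemma[OF assms(1) o(1) s(1)] by (elim exE conjE)
  obtain W where W: "e \<in> W" "open W" "W \<times> A \<subseteq> ?Q"
    using Elementary_Topology.tube_lemma[OF assms(1) o(2) s(2)] by (elim exE conjE)
  show thesis
  proof (rule that)
    show "open (V \<inter> W)" "e \<in> V \<inter> W" using V W by auto
    have "a \<cdot> v \<in> U" if "a \<in> A" "v \<in> V" for a v using V(3) that by force
    then show "A \<star> (V \<inter> W) \<subseteq> U" unfolding setmul_def by blast
    have "v \<cdot> a \<in> U" if "a \<in> A" "v \<in> W" for a v using W(3) that by force
    then show "(V \<inter> W) \<star> A \<subseteq> U" unfolding setmul_def by blast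
  qed
qed

lemma compact_nhd:
  assumes "open U" "e \<in> U"
  obtains C where "compact C" "e \<in> interior C" "\<And>x. x \<in> C \<Longrightarrow> iv x \<in> C" "C \<star> C \<subseteq> U"
proof -
  obtain V where V: "open V" "e \<in> V" "{e} \<star> V \<subseteq> U" "V \<star> {e} \<subseteq> U"
    using tube[of "{e}" U] assms by auto
  have "open ((\<lambda>p. fst p \<cdot> snd p) -` U)"
    by (auto intro!: open_vimage continuous_intros \<open>open U\<close>)
  then obtain V W where VW: "open V" "open W" "(e, e) \<in> V \<times> W"
      "V \<times> W \<subseteq> (\<lambda>p. fst p \<cdot> snd p) -` U"
    using assms(2) unfolding open_prod_def by (auto elim!: ballE[of _ _ "(e, e)"])
  have "locally compact (UNIV :: 'a set)" using lc by (simp add: lc_group_def)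
  then obtain O' C where C: "open O'" "compact C" "e \<in> O'" "O' \<subseteq> C" "C \<subseteq> V \<inter> W"
    unfolding locally_def using VW by (auto elim!: allE[of _ "V \<inter> W"])
  let ?C = "C \<inter> iv ` C"
  have "O' \<inter> iv ` O' \<subseteq> interior ?C"
    using C open_iv by (intro interior_maximal) auto
  moreover have "e \<in> O' \<inter> iv ` O'" using C by (simp add: mem_iv_image)
  moreover have "compact ?C"
    using C by (intro compact_Int compact_iv) auto
  moreover have "?C \<star> ?C \<subseteq> U"
  proof
    fix x assume "x \<in> ?C \<star> ?C"
    then obtain a b where "x = a \<cdot> b" "(a, b) \<in> V \<times> W"
      using C(5) by (auto simp: setmul_def)
    then show "x \<in> U" using VW(4) by auto
  qed
  ultimately show thesis
    by (intro that[of ?C]) (auto simp: mem_iv_image)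
qed

section \<open>Haar measure\<close>

lemma haar:
  shows sets_m [measurable_cong, simp]: "sets m = sets borel"
    and space_m [simp]: "space m = UNIV"
    and m_compact: "compact K \<Longrightarrow> emeasure m K < \<infinity>"
    and m_open_pos: "open U \<Longrightarrow> U \<noteq> {} \<Longrightarrow> emeasure m U > 0"
    and m_ltrans: "A \<in> sets borel \<Longrightarrow> emeasure m ({s} \<star> A) = emeasure m A"
    and m_rtrans: "A \<in> sets borel \<Longrightarrow> emeasure m (A \<star> {s}) = emeasure m A"
    and m_outer: "A \<in> sets borel \<Longrightarrow> emeasure m A = (INF U \<in> {U. open U \<and> A \<subseteq> U}. emeasure m U)"
proof -
  note H = unimodular[unfolded unimodular_haar_def left_haar_measure_def rtrans_image ltrans_image]
  show "sets m = sets borel" using H by (elim conjE)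
  from sets_eq_imp_space_eq[OF this] show "space m = UNIV" by simp
  have "\<forall>K. compact K \<longrightarrow> emeasure m K < \<infinity>" using H by (elim conjE)
  then show "compact K \<Longrightarrow> emeasure m K < \<infinity>" by simp
  have "\<forall>U. open U \<and> U \<noteq> {} \<longrightarrow> emeasure m U > 0" using H by (elim conjE)
  then show "open U \<Longrightarrow> U \<noteq> {} \<Longrightarrow> emeasure m U > 0" by simp
  have "\<forall>A \<in> sets borel. \<forall>s. emeasure m ({s} \<star> A) = emeasure m A" using H by (elim conjE)
  then show "A \<in> sets borel \<Longrightarrow> emeasure m ({s} \<star> A) = emeasure m A" by simp
  have "\<forall>A \<in> sets borel. \<forall>s. emeasure m (A \<star> {s}) = emeasure m A" using H by (elim conjE)
  then show "A \<in> sets borel \<Longrightarrow> emeasure m (A \<star> {s}) = emeasure m A" by simp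
  have "\<forall>A \<in> sets borel. emeasure m A = (INF U \<in> {U. open U \<and> A \<subseteq> U}. emeasure m U)"
    using H by (elim conjE)
  then show "A \<in> sets borel \<Longrightarrow> emeasure m A = (INF U \<in> {U. open U \<and> A \<subseteq> U}. emeasure m U)"
    by (rule bspec)
qed

lemma m_interior_pos: "e \<in> interior C \<Longrightarrow> C \<in> sets borel \<Longrightarrow> emeasure m C > 0"
  by (metis emeasure_mono empty_iff haar(1) interior_subset m_open_pos open_interior order_less_le_trans)

lemma compact_borel [measurable]: "compact A \<Longrightarrow> A \<in> sets borel" for A :: "'a set"
  by (simp add: compact_imp_closed)

lemma outer_approx:
  assumes "compact A" "c > 0"
  obtains U where "open U" "A \<subseteq> U" "emeasure m U < emeasure m A + ennreal c"
proof -
  have "emeasure m A < emeasure m A + ennreal c"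
    using m_compact[OF assms(1)] assms(2) by (simp add: ennreal_less_top)
  then have "(INF U \<in> {U. open U \<and> A \<subseteq> U}. emeasure m U) < emeasure m A + ennreal c"
    using m_outer[of A] assms(1) by simp
  then show thesis using that by (auto simp: INF_less_iff)
qed

section \<open>Riemann sums\<close>

text \<open>Fubini's theorem is unavailable: \<^term>\<open>m\<close> need not be \<open>\<sigma>\<close>-finite and Borel sets of the product
  need not be product measurable.\<close>

lemma borel_partition:
  assumes "compact F" "open W" "e \<in> W"
  obtains J B where "finite J" "J \<subseteq> F" "\<And>s. s \<in> J \<Longrightarrow> B s \<in> sets borel"
    "\<And>s. s \<in> J \<Longrightarrow> B s \<subseteq> W \<star> {s}" "disjoint_family_on B J" "(\<Union>s\<in>J. B s) = F"
proof -
  have "F \<subseteq> (\<Union>s\<in>F. W \<star> {s})" using assms(3) by (auto simp: mem_rtrans)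
  then obtain J where J: "J \<subseteq> F" "finite J" "F \<subseteq> (\<Union>s\<in>J. W \<star> {s})"
    using compactE_image[OF assms(1), of F "\<lambda>s. W \<star> {s}"] open_rtrans[OF assms(2)] by metis
  have "F \<in> sets borel" using assms(1) by simp
  \<comment> \<open>The induction is over Borel sets \<open>F\<close>: the remainder left after
    removing one open cell need not be compact in general, and only the finite cover has to be
    kept.\<close>
  from J(2) this J(3) have "\<exists>B. (\<forall>s\<in>J. B s \<in> sets borel \<and> B s \<subseteq> W \<star> {s}) \<and>
      disjoint_family_on B J \<and> (\<Union>s\<in>J. B s) = F"
  proof (induction J arbitrary: F rule: finite_induct)
    case empty
    then show ?case by (auto simp: disjoint_family_on_def)
  next
    case (insert s J)
    let ?G = "F - W \<star> {s}"
    have "?G \<in> sets borel" using insert.prems open_rtrans[OF assms(2)] by auto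
    moreover have "?G \<subseteq> (\<Union>s\<in>J. W \<star> {s})" using insert.prems by auto
    ultimately obtain B where B: "\<forall>t\<in>J. B t \<in> sets borel \<and> B t \<subseteq> W \<star> {t}"
      "disjoint_family_on B J" "(\<Union>s\<in>J. B s) = ?G"
      using insert.IH by metis
    let ?B = "B(s := F \<inter> W \<star> {s})"
    have "B t \<inter> W \<star> {s} = {}" if "t \<in> J" for t using B(3) that by blast
    then have "?B i \<inter> ?B j = {}" if "i \<in> insert s J" "j \<in> insert s J" "i \<noteq> j" for i j
      using that B(2) by (cases "i = s"; cases "j = s") (auto simp: disjoint_family_on_def)
    then have "disjoint_family_on ?B (insert s J)"
      by (auto simp: disjoint_family_on_def)
    moreover have "(\<Union>t\<in>insert s J. ?B t) = F"
    proof -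
      have "(\<Union>t\<in>J. ?B t) = (\<Union>t\<in>J. B t)" using insert.hyps(2) by (intro SUP_cong) auto
      then show ?thesis using B(3) by auto
    qed
    moreover have "F \<inter> W \<star> {s} \<in> sets borel"
      using insert.prems open_rtrans[OF assms(2)] by auto
    moreover have "\<forall>t\<in>insert s J. ?B t \<in> sets borel \<and> ?B t \<subseteq> W \<star> {t}"
      using B(1) calculation(3) by simp
    ultimately show ?case by blast
  qed
  then show thesis using that J by metis
qed

text \<open>Discrete double counting of the pairs \<open>(s, x)\<close> with
  \<open>x \<in> A \<star> {s}\<close> and \<open>s \<in> F\<close>. For a fixed \<open>x\<close>,
  all cells whose sample point \<open>s\<close> satisfies \<open>x \<in> A \<star> {s}\<close> lie
  in \<open>O' \<star> {x}\<close>; being disjoint, they have total mass at most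
  \<open>emeasure m O'\<close> by right invariance. The open set \<open>O'\<close> is the room for
  moving within a cell.\<close>

lemma riemann_upper:
  assumes F: "compact F" and A: "compact A"
    and nu: "sets \<nu> = sets borel" and kappa: "\<And>s. \<kappa> \<le> emeasure \<nu> (A \<star> {s})"
    and O: "open O'" "iv ` A \<subseteq> O'"
  shows "\<kappa> * emeasure m F \<le> emeasure m O' * emeasure \<nu> (A \<star> F)"
proof -
  obtain W where W: "open W" "e \<in> W" "W \<star> (iv ` A) \<subseteq> O'"
    using tube[OF compact_iv[OF A] O] by metis
  obtain J B where J: "finite J" "J \<subseteq> F" "\<And>s. s \<in> J \<Longrightarrow> B s \<in> sets borel"
    "\<And>s. s \<in> J \<Longrightarrow> B s \<subseteq> W \<star> {s}" "disjoint_family_on B J" "(\<Union>s\<in>J. B s) = F"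
    by (rule borel_partition[OF F W(1,2)]) blast
  note [measurable_cong] = nu
  have [measurable]: "A \<star> {s} \<in> sets borel" "A \<star> F \<in> sets borel" for s
    using A F by (auto intro!: compact_borel compact_setmul)
  have pw: "(\<Sum>s\<in>J. emeasure m (B s) * indicator (A \<star> {s}) x) \<le> emeasure m O' * indicator (A \<star> F) x" for x
  proof (cases "x \<in> A \<star> F")
    case False
    then have "x \<notin> A \<star> {s}" if "s \<in> J" for s
      using that J(2) setmul_mono[of A A "{s}" F] by blast
    then show ?thesis by simp
  next
    case True
    let ?J = "{s\<in>J. x \<in> A \<star> {s}}"
    have "(\<Sum>s\<in>J. emeasure m (B s) * indicator (A \<star> {s}) x) = (\<Sum>s\<in>?J. emeasure m (B s))"
      using J(1) by (intro sum.mono_neutral_cong_right) auto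
    also have "\<dots> = emeasure m (\<Union>s\<in>?J. B s)"
      using J(1,3,5) by (intro sum_emeasure) (auto simp: disjoint_family_on_def)
    also have "\<dots> \<le> emeasure m (O' \<star> {x})"
    proof (rule emeasure_mono)
      show "(\<Union>s\<in>?J. B s) \<subseteq> O' \<star> {x}"
      proof
        fix t assume "t \<in> (\<Union>s\<in>?J. B s)"
        then obtain s where s: "s \<in> J" "x \<cdot> iv s \<in> A" "t \<cdot> iv s \<in> W"
          using J(4) by (auto simp: mem_rtrans[symmetric])
        have "t \<cdot> iv s \<cdot> iv (x \<cdot> iv s) \<in> W \<star> (iv ` A)" using s by blast
        then have "t \<cdot> iv x \<in> W \<star> (iv ` A)"
          by (simp add: inverse_distrib_swap assoc)
        then show "t \<in> O' \<star> {x}" using W(3) by (auto simp: mem_rtrans)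
      qed
    qed (use open_rtrans[OF O(1)] in simp)
    also have "\<dots> = emeasure m O'" using O(1) by (simp add: m_rtrans)
    finally show ?thesis using True by simp
  qed
  have "emeasure m F = (\<Sum>s\<in>J. emeasure m (B s))"
    using J by (subst sum_emeasure) auto
  then have "\<kappa> * emeasure m F = (\<Sum>s\<in>J. emeasure m (B s) * \<kappa>)"
    by (simp add: sum_distrib_left mult.commute)
  also have "\<dots> \<le> (\<Sum>s\<in>J. emeasure m (B s) * emeasure \<nu> (A \<star> {s}))"
    by (intro sum_mono mult_left_mono kappa) auto
  also have "\<dots> = (\<integral>\<^sup>+x. (\<Sum>s\<in>J. emeasure m (B s) * indicator (A \<star> {s}) x) \<partial>\<nu>)"
    by (subst nn_integral_sum) (auto simp: nu nn_integral_cmult_indicator)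
  also have "\<dots> \<le> (\<integral>\<^sup>+x. emeasure m O' * indicator (A \<star> F) x \<partial>\<nu>)"
    by (intro nn_integral_mono pw)
  also have "\<dots> = emeasure m O' * emeasure \<nu> (A \<star> F)"
    by (simp add: nn_integral_cmult_indicator nu)
  finally show ?thesis .
qed

text \<open>Outer regularity lets \<open>O'\<close> shrink to the inverse of \<open>A\<close>; the
  error is multiplied by the measure of \<open>A \<star> F\<close>, which is finite because \<nu> is
  locally finite.\<close>

lemma riemann_upper':
  assumes F: "compact F" and A: "compact A"
    and nu: "locally_finite_measure \<nu>" and kappa: "\<And>s. \<kappa> \<le> emeasure \<nu> (A \<star> {s})"
  shows "\<kappa> * emeasure m F \<le> emeasure m (iv ` A) * emeasure \<nu> (A \<star> F)"
proof -
  have fin: "emeasure \<nu> (A \<star> F) < \<infinity>" and nu': "sets \<nu> = sets borel"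
    using nu compact_setmul[OF A F] by (auto simp: locally_finite_measure_def)
  have "\<kappa> * emeasure m F \<le> emeasure m (iv ` A) * emeasure \<nu> (A \<star> F) + ennreal c" if "c > 0" for c
  proof -
    define v where "v = enn2real (emeasure \<nu> (A \<star> F))"
    have v: "emeasure \<nu> (A \<star> F) = ennreal v" "v \<ge> 0" using fin by (auto simp: v_def)
    \<comment> \<open>The summand 1 allows \<open>v = 0\<close>; the error is
      \<open>c / (v + 1) * v \<le> c\<close>.\<close>
    have "c / (v + 1) > 0" using v that by simp
    then obtain U where U: "open U" "iv ` A \<subseteq> U" "emeasure m U < emeasure m (iv ` A) + ennreal (c / (v + 1))"
      using outer_approx[OF compact_iv[OF A]] by metis
    have "\<kappa> * emeasure m F \<le> emeasure m U * emeasure \<nu> (A \<star> F)"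
      by (rule riemann_upper[OF F A nu' kappa U(1,2)])
    also have "\<dots> \<le> (emeasure m (iv ` A) + ennreal (c / (v + 1))) * emeasure \<nu> (A \<star> F)"
      using U(3) by (intro mult_right_mono) auto
    also have "\<dots> = emeasure m (iv ` A) * emeasure \<nu> (A \<star> F) + ennreal (c / (v + 1) * v)"
      using v that by (subst ennreal_mult) (simp_all add: distrib_right)
    also have "\<dots> \<le> emeasure m (iv ` A) * emeasure \<nu> (A \<star> F) + ennreal c"
      using v that by (intro add_left_mono ennreal_leI) (simp add: field_simps)
    finally show ?thesis .
  qed
  then show ?thesis by (blast intro: ennreal_le_epsilon)
qed

end

text \<open>Cantor's intersection theorem. It serves twice in the upper comparison: to find a factor
  lying in all neighbourhoods \<open>C n\<close> at once, and to find a limit of translates where no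
  convergent subsequence is at hand.\<close>

lemma nested_compact_nonempty:
  fixes D :: "nat \<Rightarrow> 'a::t2_space set"
  assumes "\<And>n. compact (D n)" "\<And>n. D n \<noteq> {}" "decseq D"
  shows "(\<Inter>n. D n) \<noteq> {}"
proof -
  have "D 0 \<inter> (\<Inter>n. D n) \<noteq> {}"
  proof (rule compact_imp_fip_image)
    fix I :: "nat set" assume I: "finite I" "I \<subseteq> UNIV"
    have "D (Max (insert 0 I)) \<subseteq> D 0 \<inter> (\<Inter>i\<in>I. D i)"
      using I(1) by (auto intro: decseqD[OF assms(3), THEN subsetD, rotated])
    then show "D 0 \<inter> (\<Inter>i\<in>I. D i) \<noteq> {}" using assms(2) by blast
  qed (auto simp: assms(1) compact_imp_closed)
  then show ?thesis by blast
qed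

context unimodular_lc_group
begin

section \<open>Inversion invariance of Haar measure and the lower comparison\<close>

lemma setmul_iv: "iv ` (A \<star> B) = iv ` B \<star> iv ` A"
proof
  show "iv ` (A \<star> B) \<subseteq> iv ` B \<star> iv ` A"
    unfolding setmul_def by (auto simp: inverse_distrib_swap) blast
  have "x \<in> iv ` (A \<star> B)" if x: "x = iv b \<cdot> iv a" "a \<in> A" "b \<in> B" for x a b
    using x by (simp flip: inverse_distrib_swap) blast
  then show "iv ` B \<star> iv ` A \<subseteq> iv ` (A \<star> B)" unfolding setmul_def by blast
qed

text \<open>The Riemann sum inequality is applied to the image of \<^term>\<open>m\<close> under inversion and a small symmetric
  neighbourhood of \<^term>\<open>e\<close>.\<close>

lemma m_iv_le: assumes X: "compact X" shows "emeasure m X \<le> emeasure m (iv ` X)"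
proof -
  define \<mu> where "\<mu> = distr m borel iv"
  have [measurable]: "iv \<in> borel_measurable borel"
    by (intro borel_measurable_continuous_onI continuous_intros)
  have mu: "emeasure \<mu> Y = emeasure m (iv ` Y)" if "Y \<in> sets borel" for Y
  proof -
    have "iv -` Y = iv ` Y" by (auto simp: mem_iv_image)
    with that show ?thesis unfolding \<mu>_def by (subst emeasure_distr) auto
  qed
  have "sets \<mu> = sets borel" by (simp add: \<mu>_def)
  then have lf: "locally_finite_measure \<mu>"
    unfolding locally_finite_measure_def
    using m_compact[OF compact_iv] by (simp add: mu)
  have "emeasure m X \<le> emeasure m (iv ` X) + ennreal c" if c: "c > 0" for c
  proof -
    obtain U where U: "open U" "iv ` X \<subseteq> U" "emeasure m U < emeasure m (iv ` X) + ennreal c"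
      by (rule outer_approx[OF compact_iv[OF X] c])
    obtain V0 where V0: "open V0" "e \<in> V0" "iv ` X \<star> V0 \<subseteq> U"
      using tube[OF compact_iv[OF X] U(1,2)] by metis
    obtain V where V: "compact V" "e \<in> interior V" "\<And>x. x \<in> V \<Longrightarrow> iv x \<in> V" "V \<star> V \<subseteq> V0"
      using compact_nhd[OF V0(1,2)] by metis
    have ivV: "iv ` V = V" using V(3) by (auto simp: mem_iv_image)
    have "e \<in> V" using V(2) interior_subset by blast
    then have "V \<subseteq> V0" using V(4) setmulI[of e V] by force
    \<comment> \<open>The inverse of \<open>V \<star> {s}\<close> is a left translate of the
      symmetric set \<open>V\<close>. So the lower bound in the Riemann estimate is
      \<open>emeasure m V\<close> for every \<open>s\<close>, and this positive finite factor
      cancels.\<close>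
    have "emeasure \<mu> (V \<star> {s}) = emeasure m V" for s
      using V(1) m_ltrans[of V "iv s"] ivV by (simp add: mu setmul_iv borel_rtrans)
    then have "emeasure m V * emeasure m X \<le> emeasure m (iv ` V) * emeasure \<mu> (V \<star> X)"
      by (intro riemann_upper'[OF X V(1) lf]) simp
    then have "emeasure m V * emeasure m X \<le> emeasure m V * emeasure \<mu> (V \<star> X)" by (simp only: ivV)
    moreover have "emeasure m V \<noteq> 0" "emeasure m V \<noteq> top"
      using m_interior_pos[OF V(2)] m_compact[OF V(1)] compact_borel[OF V(1)] by auto
    ultimately have "emeasure m X \<le> emeasure \<mu> (V \<star> X)"
      using ennreal_mult_le_mult_iff by blast
    also have "\<dots> = emeasure m (iv ` X \<star> V)"
      using V(1) X by (simp add: mu compact_setmul setmul_iv ivV)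
    also have "\<dots> \<le> emeasure m U"
      using U(1) V0(3) setmul_mono[OF order_refl \<open>V \<subseteq> V0\<close>] by (intro emeasure_mono) auto
    finally show ?thesis using U(3) by simp
  qed
  then show ?thesis by (blast intro: ennreal_le_epsilon)
qed

lemma m_iv: "compact X \<Longrightarrow> emeasure m (iv ` X) = emeasure m X"
  using m_iv_le[of X] m_iv_le[OF compact_iv[of X]] by (simp add: antisym)

text \<open>Inversion invariance turns the factor from the Riemann estimate into
  \<open>emeasure m A\<close>, which is positive and finite and cancels.\<close>

lemma beurling_le_leptin_lower:
  assumes "compact F" "compact A" "emeasure m A > 0" "locally_finite_measure \<nu>"
    "\<And>s. \<kappa> * emeasure m A \<le> emeasure \<nu> (A \<star> {s})"
  shows "\<kappa> * emeasure m F \<le> emeasure \<nu> (A \<star> F)"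
proof -
  have "\<kappa> * emeasure m A * emeasure m F \<le> emeasure m (iv ` A) * emeasure \<nu> (A \<star> F)"
    by (rule riemann_upper'[OF assms(1,2,4,5)])
  then have "emeasure m A * (\<kappa> * emeasure m F) \<le> emeasure m A * emeasure \<nu> (A \<star> F)"
    by (simp add: m_iv assms mult_ac)
  then show ?thesis using m_compact[OF assms(2)] assms(3) by (simp add: ennreal_mult_le_mult_iff)
qed

section \<open>The upper comparison\<close>

text \<open>For \<open>v\<close> near \<open>e\<close>, both \<open>A\<close> and
  \<open>A \<star> {v}\<close> lie in one open set that exceeds their common measure by less than
  \<open>c\<close>.\<close>

lemma rtrans_diff_small:
  assumes A: "compact A" and c: "c > 0"
  obtains U where "open U" "e \<in> U" "\<And>v. v \<in> U \<Longrightarrow> emeasure m (A - A \<star> {v}) < ennreal c"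
proof -
  obtain O' where O': "open O'" "A \<subseteq> O'" "emeasure m O' < emeasure m A + ennreal c"
    by (rule outer_approx[OF A c])
  obtain U where U: "open U" "e \<in> U" "A \<star> U \<subseteq> O'" using tube[OF A O'(1,2)] by metis
  have "emeasure m (A - A \<star> {v}) < ennreal c" if v: "v \<in> U" for v
  proof -
    have sub: "A \<star> {v} \<subseteq> O'" by (rule order_trans[OF setmul_mono U(3)]) (use v in auto)
    have "emeasure m (A - A \<star> {v}) \<le> emeasure m (O' - A \<star> {v})"
      using O'(1,2) A by (intro emeasure_mono) (auto simp: borel_rtrans)
    also have "\<dots> = emeasure m O' - emeasure m A"
      using O'(1) sub A m_compact[OF A] by (subst emeasure_Diff) (auto simp: borel_rtrans m_rtrans)
    also have "\<dots> < ennreal c"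
    proof -
      have "emeasure m A < top" using m_compact[OF A] by simp
      moreover have "emeasure m A \<le> emeasure m O'" using O'(1,2) by (intro emeasure_mono) auto
      ultimately show ?thesis using O'(3) by (simp add: minus_less_iff_ennreal add.commute)
    qed
    finally show ?thesis .
  qed
  then show thesis by (rule that[OF U(1,2)])
qed

text \<open>As \<^term>\<open>\<nu>\<close> need not be regular, \<open>\<nu>(AV)\<close> need not approach \<open>\<nu>(A)\<close> as \<open>V\<close> shrinks. Hence \<open>A\<close> is first
  replaced by \<open>A0 = {x. xN \<subseteq> A}\<close>, where \<open>N\<close> is a countable intersection of neighbourhoods \<open>C n\<close>, chosen
  so small that \<open>m(A0) = m(A)\<close>; then \<open>A0\<close> is the decreasing intersection of the sets \<open>A0 C n\<close>.\<close>

lemma leptin_le_beurling_upper: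
  assumes A: "compact A" "emeasure m A > 0" and nu: "locally_finite_measure \<nu>"
    and kappa: "\<And>s. emeasure \<nu> (A \<star> {s}) \<le> \<kappa>"
  obtains K where "compact K" "K \<noteq> {}"
    "\<And>F. compact F \<Longrightarrow> emeasure m A * emeasure \<nu> F \<le> emeasure m (K \<star> F) * \<kappa>"
proof -
  \<comment> \<open>Symmetry, together with the condition on squares imposed in the dependent
    choice, makes the intersection \<open>N\<close> a subgroup. The bound \<open>1 / Suc n\<close>
    makes \<open>A - A \<star> {v}\<close> a null set for each \<open>v \<in> N\<close>.\<close>
  define P where "P n C \<longleftrightarrow> compact C \<and> e \<in> interior C \<and> (\<forall>v\<in>C. iv v \<in> C) \<and>
    (\<forall>v\<in>C. emeasure m (A - A \<star> {v}) < ennreal (1 / Suc n))" for n C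
  have ex: "\<exists>D. P n D \<and> D \<star> D \<subseteq> interior C" if C: "e \<in> interior C" for C n
  proof -
    obtain U where U: "open U" "e \<in> U" "\<And>v. v \<in> U \<Longrightarrow> emeasure m (A - A \<star> {v}) < ennreal (1 / Suc n)"
      by (rule rtrans_diff_small[OF A(1), of "1 / Suc n"]) auto
    have "open (U \<inter> interior C)" "e \<in> U \<inter> interior C" using U C by auto
    then obtain D where D: "compact D" "e \<in> interior D"
      "\<And>x. x \<in> D \<Longrightarrow> iv x \<in> D" "D \<star> D \<subseteq> U \<inter> interior C"
      using compact_nhd by metis
    have "D \<subseteq> D \<star> D"
    proof
      fix x assume "x \<in> D"
      moreover have "e \<in> D" using D(2) interior_subset by blast
      ultimately have "e \<cdot> x \<in> D \<star> D" by blast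
      then show "x \<in> D \<star> D" by simp
    qed
    then have "P n D" using D U(3) unfolding P_def by blast
    then show ?thesis using D(4) by blast
  qed
  have "\<exists>C. \<forall>n. P n (C n) \<and> C (Suc n) \<star> C (Suc n) \<subseteq> interior (C n)"
  proof (rule dependent_nat_choice)
    show "\<exists>C. P 0 C" using ex[of UNIV 0] by auto
    show "\<exists>D. P (Suc n) D \<and> D \<star> D \<subseteq> interior C" if "P n C" for C n
      using ex[of C "Suc n"] that unfolding P_def by blast
  qed
  then obtain C where PC: "\<And>n. P n (C n)" and "\<And>n. C (Suc n) \<star> C (Suc n) \<subseteq> interior (C n)"
    by blast
  then have CC: "C (Suc n) \<star> C (Suc n) \<subseteq> C n" for n using interior_subset by blast
  have C: "compact (C n)" "e \<in> interior (C n)" "e \<in> C n" for n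
    using PC[of n] interior_subset unfolding P_def by blast+
  have Civ: "v \<in> C n \<Longrightarrow> iv v \<in> C n" for v n using PC[of n] by (simp add: P_def)
  have Cdec: "C (Suc n) \<subseteq> C n" for n
  proof
    fix x assume "x \<in> C (Suc n)"
    then have "e \<cdot> x \<in> C (Suc n) \<star> C (Suc n)" using C(3) by blast
    then show "x \<in> C n" using CC by auto
  qed
  define N where "N = (\<Inter>n. C n)"
  have N_e: "e \<in> N" using C by (simp add: N_def)
  have N_iv: "iv v \<in> N" if "v \<in> N" for v using that Civ by (simp add: N_def)
  have N_mult: "v \<cdot> w \<in> N" if "v \<in> N" "w \<in> N" for v w
    unfolding N_def
  proof
    fix n
    have "v \<cdot> w \<in> C (Suc n) \<star> C (Suc n)" using that unfolding N_def by blast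
    then show "v \<cdot> w \<in> C n" using CC by blast
  qed
  have N_null: "emeasure m (A - A \<star> {v}) = 0" if "v \<in> N" for v
  proof (rule antisym)
    have "emeasure m (A - A \<star> {v}) \<le> 0 + ennreal c" if "c > 0" for c
    proof -
      obtain n where "inverse (real (Suc n)) < c" using \<open>c > 0\<close> reals_Archimedean by blast
      moreover have "emeasure m (A - A \<star> {v}) < ennreal (1 / Suc n)"
        using PC[of n] \<open>v \<in> N\<close> by (simp add: P_def N_def)
      ultimately show ?thesis
        by (metis add_0 ennreal_leI inverse_eq_divide less_imp_le order_trans)
    qed
    then show "emeasure m (A - A \<star> {v}) \<le> 0" by (blast intro: ennreal_le_epsilon)
  qed simp
  define A0 where "A0 = (\<Inter>v\<in>N. A \<star> {v})"
  have A0_sub: "A0 \<subseteq> A" using N_e by (auto simp: A0_def mem_rtrans)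
  have closed_tr: "closed (A \<star> {v})" for v
    by (intro compact_imp_closed compact_setmul A) auto
  have A0_compact: "compact A0"
  proof -
    have "A0 = A \<inter> A0" using A0_sub by auto
    moreover have "closed A0" unfolding A0_def using closed_tr by auto
    ultimately show ?thesis using A(1) by (metis compact_Int_closed)
  qed
  have A0_N: "x \<cdot> v \<in> A0" if x: "x \<in> A0" and v: "v \<in> N" for x v
    unfolding A0_def
  proof
    fix w assume "w \<in> N"
    then have "x \<in> A \<star> {w \<cdot> iv v}" using x v N_iv N_mult unfolding A0_def by blast
    then show "x \<cdot> v \<in> A \<star> {w}" by (simp add: mem_rtrans inverse_distrib_swap assoc)
  qed
  \<comment> \<open>\<open>A0\<close> removes possibly uncountably many null sets from
    \<open>A\<close>. Around any open \<open>O'\<close> containing \<open>A0\<close>, compactness of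
    \<open>A - O'\<close> reduces them to finitely many, and outer regularity at \<open>A0\<close>
    concludes.\<close>
  have m_A0: "emeasure m A \<le> emeasure m A0"
  proof -
    have "emeasure m A \<le> emeasure m O'" if O': "open O'" "A0 \<subseteq> O'" for O'
    proof -
      have "compact (A - O')" using A(1) O'(1) by (simp add: compact_diff)
      moreover have "A - O' \<subseteq> (\<Union>v\<in>N. - (A \<star> {v}))" using O'(2) by (auto simp: A0_def)
      moreover have "open (- (A \<star> {v}))" for v using closed_tr by auto
      ultimately obtain J where J: "J \<subseteq> N" "finite J" "A - O' \<subseteq> (\<Union>v\<in>J. - (A \<star> {v}))"
        using compactE_image[of "A - O'" N "\<lambda>v. - (A \<star> {v})"] by metis
      have "A \<subseteq> O' \<union> (\<Union>v\<in>J. A - A \<star> {v})" using J(3) by auto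
      moreover have sets: "A - A \<star> {v} \<in> sets m" for v using A(1) by (simp add: borel_rtrans sets.Diff)
      then have U: "(\<Union>v\<in>J. A - A \<star> {v}) \<in> sets m" using J(2) by (intro sets.finite_UN)
      moreover have "O' \<in> sets m" using O'(1) by simp
      ultimately have "emeasure m A \<le> emeasure m (O' \<union> (\<Union>v\<in>J. A - A \<star> {v}))"
        by (intro emeasure_mono sets.Un)
      also have "\<dots> \<le> emeasure m O' + emeasure m (\<Union>v\<in>J. A - A \<star> {v})"
        using \<open>O' \<in> sets m\<close> U by (rule emeasure_subadditive)
      also have "emeasure m (\<Union>v\<in>J. A - A \<star> {v}) \<le> (\<Sum>v\<in>J. emeasure m (A - A \<star> {v}))"
        using J(2) sets by (intro emeasure_subadditive_finite) blast+
      also have "\<dots> = 0" using J N_null by (intro sum.neutral) blast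
      finally show ?thesis by (simp add: add_left_mono)
    qed
    then show ?thesis using m_outer[of A0] A0_compact by (simp add: le_INF_iff)
  qed
  define B where "B n = A0 \<star> C n" for n
  have B_compact: "compact (B n)" for n unfolding B_def by (intro compact_setmul A0_compact C)
  have B_step: "B (Suc n) \<star> {v} \<subseteq> B n" if "v \<in> C (Suc n)" for n v
  proof -
    have "B (Suc n) \<star> {v} \<subseteq> A0 \<star> (C (Suc n) \<star> C (Suc n))"
      unfolding B_def setmul_assoc using that by (intro setmul_mono) auto
    also have "\<dots> \<subseteq> B n" unfolding B_def by (intro setmul_mono CC) auto
    finally show ?thesis .
  qed
  have B_dec: "decseq B" unfolding B_def by (intro decseq_SucI setmul_mono Cdec) auto
  have A0_B: "A0 \<subseteq> B n" for n
  proof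
    fix x assume "x \<in> A0"
    then have "x \<cdot> e \<in> B n" unfolding B_def using C(3) by blast
    then show "x \<in> B n" by simp
  qed
  \<comment> \<open>For each \<open>n\<close> the point factors as an element of \<open>A0\<close>
    times an element of \<open>C n\<close>, with a factor depending on \<open>n\<close>. Compactness
    yields one factor in \<open>N\<close> that works for all \<open>n\<close>, and \<open>A0\<close>
    is stable under \<open>N\<close>.\<close>
  have B_Inter: "(\<Inter>n. B n) \<subseteq> A0"
  proof
    fix x assume x: "x \<in> (\<Inter>n. B n)"
    define D where "D n = C n \<inter> iv ` A0 \<star> {x}" for n
    have "(\<Inter>n. D n) \<noteq> {}"
    proof (rule nested_compact_nonempty)
      show "compact (D n)" for n
        unfolding D_def by (intro compact_Int C compact_setmul compact_iv A0_compact) auto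
      show "decseq D" unfolding D_def using Cdec by (intro decseq_SucI) blast
      show "D n \<noteq> {}" for n
      proof -
        obtain a c where "a \<in> A0" "c \<in> C n" "x = a \<cdot> c" using x unfolding B_def setmul_def by blast
        then have "c \<in> D n" by (simp add: D_def mem_rtrans mem_iv_image inverse_distrib_swap assoc)
        then show ?thesis by blast
      qed
    qed
    then obtain c where cD: "\<And>n. c \<in> D n" by blast
    have "c \<in> N" using cD unfolding D_def N_def by blast
    have "c \<cdot> iv x \<in> iv ` A0" using cD[of 0] unfolding D_def by (simp add: mem_rtrans)
    then have "x \<cdot> iv c \<in> A0" by (simp add: mem_iv_image inverse_distrib_swap)
    from A0_N[OF this \<open>c \<in> N\<close>]
    show "x \<in> A0" by (simp add: assoc)
  qed
  have nu_borel: "sets \<nu> = sets borel" and nu_fin: "compact X \<Longrightarrow> emeasure \<nu> X < \<infinity>" for X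
    using nu by (auto simp: locally_finite_measure_def)
  note [measurable_cong] = nu_borel
  have Bs: "compact (B n \<star> {s})" for n s by (intro compact_setmul B_compact) auto
  have main: "emeasure m A * emeasure \<nu> F \<le> emeasure m (iv ` B 0 \<star> F) * \<kappa>" if F: "compact F" for F
  proof (cases "F = {}")
    case False
    \<comment> \<open>The domain of summation must not depend on \<open>n\<close>. Since the sets
      \<open>B n\<close> decrease, \<open>S\<close> contains the inverse of \<open>B (Suc n)\<close>
      translated by any \<open>x \<in> F\<close>.\<close>
    define S where "S = iv ` B 0 \<star> F"
    have S: "compact S" unfolding S_def by (intro compact_setmul compact_iv B_compact F)
    have "A0 \<noteq> {}" using m_A0 A(2) by auto
    \<comment> \<open>Choose the best of finitely many sample points. A point \<open>t\<close> with
      \<open>x \<in> B (Suc n) \<star> {t}\<close> lies in a cell whose sample point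
      \<open>s\<close> has \<open>x \<in> B n \<star> {s}\<close>: the index drops by one to pay for
      moving from \<open>t\<close> to \<open>s\<close>. Hence the Riemann sum dominates
      \<open>emeasure m A * emeasure \<nu> F\<close>, and it is at most its largest value times
      \<open>emeasure m S\<close>.\<close>
    have ex: "\<exists>s\<in>S. emeasure m A * emeasure \<nu> F \<le> emeasure m S * emeasure \<nu> (B n \<star> {s})" for n
    proof -
      obtain J c where J: "finite J" "J \<subseteq> S" "\<And>s. s \<in> J \<Longrightarrow> c s \<in> sets borel"
        "\<And>s. s \<in> J \<Longrightarrow> c s \<subseteq> interior (C (Suc n)) \<star> {s}" "disjoint_family_on c J" "(\<Union>s\<in>J. c s) = S"
        by (rule borel_partition[OF S, of "interior (C (Suc n))"]) (use C in auto)
      have [measurable]: "F \<in> sets borel" "B n \<star> {s} \<in> sets borel" for s using F Bs by auto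
      have pw: "emeasure m A * indicator F x \<le> (\<Sum>s\<in>J. emeasure m (c s) * indicator (B n \<star> {s}) x)" for x
      proof (cases "x \<in> F")
        case True
        let ?J = "{s\<in>J. x \<in> B n \<star> {s}}"
        have "emeasure m A \<le> emeasure m (B (Suc n))"
          using m_A0 emeasure_mono[OF A0_B[of "Suc n"], of m] B_compact by (auto intro: order_trans)
        also have "\<dots> = emeasure m (iv ` B (Suc n) \<star> {x})"
          using B_compact by (simp add: m_iv m_rtrans compact_iv)
        also have "\<dots> \<le> emeasure m (\<Union>s\<in>?J. c s)"
        proof (rule emeasure_mono)
          show "(\<Union>s\<in>?J. c s) \<in> sets m" using J by auto
          show "iv ` B (Suc n) \<star> {x} \<subseteq> (\<Union>s\<in>?J. c s)"
          proof
            fix t assume t: "t \<in> iv ` B (Suc n) \<star> {x}"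
            have "iv ` B (Suc n) \<star> {x} \<subseteq> S" unfolding S_def
              using True decseqD[OF B_dec, of 0 "Suc n"] by (intro setmul_mono image_mono) auto
            with t J(6) obtain s where s: "s \<in> J" "t \<in> c s" by blast
            then have "t \<cdot> iv s \<in> C (Suc n)"
              using J(4) interior_subset by (fastforce simp: mem_rtrans[symmetric])
            moreover have "x \<cdot> iv t \<in> B (Suc n)"
              using t by (simp add: mem_rtrans mem_iv_image inverse_distrib_swap)
            ultimately have "x \<cdot> iv t \<cdot> (t \<cdot> iv s) \<in> B n" using B_step by blast
            then have "x \<in> B n \<star> {s}" by (simp add: mem_rtrans assoc)
            then show "t \<in> (\<Union>s\<in>?J. c s)" using s by blast
          qed
        qed
        also have "\<dots> = (\<Sum>s\<in>?J. emeasure m (c s))"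
          using J(1,3,5) by (intro sum_emeasure[symmetric]) (auto simp: disjoint_family_on_def)
        also have "\<dots> = (\<Sum>s\<in>J. emeasure m (c s) * indicator (B n \<star> {s}) x)"
          using J(1) by (intro sum.mono_neutral_cong_left) auto
        finally show ?thesis using True by simp
      qed simp
      have "S \<noteq> {}" using False \<open>A0 \<noteq> {}\<close> A0_B[of 0] unfolding S_def setmul_def by blast
      then have "J \<noteq> {}" using J(6) by auto
      then obtain s where s: "s \<in> J" and max: "\<And>t. t \<in> J \<Longrightarrow> emeasure \<nu> (B n \<star> {t}) \<le> emeasure \<nu> (B n \<star> {s})"
      proof -
        let ?I = "(\<lambda>t. emeasure \<nu> (B n \<star> {t})) ` J"
        have "Max ?I \<in> ?I" using J(1) \<open>J \<noteq> {}\<close> by (intro Max_in) auto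
        then obtain s where "s \<in> J" "Max ?I = emeasure \<nu> (B n \<star> {s})" by blast
        moreover have "emeasure \<nu> (B n \<star> {t}) \<le> Max ?I" if "t \<in> J" for t
          using J(1) that by (intro Max_ge) auto
        ultimately show thesis using that by simp
      qed
      have "emeasure m A * emeasure \<nu> F = (\<integral>\<^sup>+x. emeasure m A * indicator F x \<partial>\<nu>)"
        by (simp add: nn_integral_cmult_indicator nu_borel)
      also have "\<dots> \<le> (\<integral>\<^sup>+x. (\<Sum>s\<in>J. emeasure m (c s) * indicator (B n \<star> {s}) x) \<partial>\<nu>)"
        by (intro nn_integral_mono pw)
      also have "\<dots> = (\<Sum>s\<in>J. emeasure m (c s) * emeasure \<nu> (B n \<star> {s}))"
        by (subst nn_integral_sum) (auto simp: nu_borel nn_integral_cmult_indicator)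
      also have "\<dots> \<le> (\<Sum>t\<in>J. emeasure m (c t) * emeasure \<nu> (B n \<star> {s}))"
        by (intro sum_mono mult_left_mono max) auto
      also have "\<dots> = emeasure m S * emeasure \<nu> (B n \<star> {s})"
        using J by (subst sum_distrib_right[symmetric], subst sum_emeasure) auto
      finally show ?thesis using s J(2) by blast
    qed
    \<comment> \<open>The measure of \<open>B n \<star> {s}\<close> need not be continuous in
      \<open>s\<close>, so \<open>T n\<close> need not be closed. A point of all the closures is
      nevertheless as good as a member: a nearby \<open>t \<in> T (Suc n)\<close> satisfies
      \<open>B (Suc n) \<star> {t} \<subseteq> B n \<star> {s}\<close>.\<close>
    define T where "T n = {s\<in>S. emeasure m A * emeasure \<nu> F \<le> emeasure m S * emeasure \<nu> (B n \<star> {s})}" for n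
    have "(\<Inter>n. closure (T n)) \<noteq> {}"
    proof (rule nested_compact_nonempty)
      show "compact (closure (T n))" for n
      proof -
        have "closure (T n) \<subseteq> S"
          using compact_imp_closed[OF S] by (intro closure_minimal) (auto simp: T_def)
        then show ?thesis using compact_Int_closed[OF S closed_closure, of "T n"] by (simp add: Int_absorb1)
      qed
      show "closure (T n) \<noteq> {}" for n using ex[of n] by (auto simp: T_def)
      have "T (Suc n) \<subseteq> T n" for n
      proof
        fix s assume s: "s \<in> T (Suc n)"
        have "emeasure \<nu> (B (Suc n) \<star> {s}) \<le> emeasure \<nu> (B n \<star> {s})"
          using Bs[of n s] decseq_SucD[OF B_dec] by (intro emeasure_mono setmul_mono) (auto simp: nu_borel)
        then have "emeasure m S * emeasure \<nu> (B (Suc n) \<star> {s}) \<le> emeasure m S * emeasure \<nu> (B n \<star> {s})"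
          by (rule mult_left_mono) simp
        then show "s \<in> T n" using s by (auto simp: T_def)
      qed
      then show "decseq (\<lambda>n. closure (T n))" by (intro decseq_SucI closure_mono)
    qed
    then obtain s where s: "\<And>n. s \<in> closure (T n)" by blast
    have le: "emeasure m A * emeasure \<nu> F \<le> emeasure m S * emeasure \<nu> (B n \<star> {s})" for n
    proof -
      let ?U = "interior (C (Suc n)) \<star> {s}"
      have "open ?U" "s \<in> ?U" using C(2) by (auto simp: open_rtrans mem_rtrans)
      then have "?U \<inter> T (Suc n) \<noteq> {}"
        using s[of "Suc n"] open_Int_closure_eq_empty by blast
      then obtain t where t: "t \<cdot> iv s \<in> C (Suc n)" "t \<in> T (Suc n)"
        using interior_subset by (fastforce simp: mem_rtrans)
      have "B (Suc n) \<star> {t} \<subseteq> B n \<star> {s}"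
      proof
        fix x assume "x \<in> B (Suc n) \<star> {t}"
        then have "x \<cdot> iv t \<cdot> (t \<cdot> iv s) \<in> B n" using t(1) B_step by (auto simp: mem_rtrans)
        then show "x \<in> B n \<star> {s}" by (simp add: mem_rtrans assoc)
      qed
      then have "emeasure m S * emeasure \<nu> (B (Suc n) \<star> {t}) \<le> emeasure m S * emeasure \<nu> (B n \<star> {s})"
        using Bs[of n s] by (intro mult_left_mono emeasure_mono) (auto simp: nu_borel)
      then show ?thesis using t(2) by (auto simp: T_def)
    qed
    have "(\<lambda>n. emeasure \<nu> (B n \<star> {s})) \<longlonglongrightarrow> emeasure \<nu> (\<Inter>n. B n \<star> {s})"
    proof (rule Lim_emeasure_decseq)
      show "decseq (\<lambda>n. B n \<star> {s})"
        using decseq_SucD[OF B_dec] by (intro decseq_SucI setmul_mono) auto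
      show "range (\<lambda>n. B n \<star> {s}) \<subseteq> sets \<nu>" using Bs nu_borel by auto
      show "emeasure \<nu> (B n \<star> {s}) \<noteq> \<infinity>" for n using nu_fin[OF Bs] by (simp add: less_top)
    qed
    then have "(\<lambda>n. emeasure m S * emeasure \<nu> (B n \<star> {s})) \<longlonglongrightarrow> emeasure m S * emeasure \<nu> (\<Inter>n. B n \<star> {s})"
      using m_compact[OF S] by (intro ennreal_tendsto_cmult) auto
    then have "emeasure m A * emeasure \<nu> F \<le> emeasure m S * emeasure \<nu> (\<Inter>n. B n \<star> {s})"
      using le by (intro LIMSEQ_le_const) auto
    also have "\<dots> \<le> emeasure m S * emeasure \<nu> (A \<star> {s})"
    proof (intro mult_left_mono emeasure_mono)
      show "(\<Inter>n. B n \<star> {s}) \<subseteq> A \<star> {s}" 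
      proof
        fix x assume "x \<in> (\<Inter>n. B n \<star> {s})"
        then have "x \<cdot> iv s \<in> (\<Inter>n. B n)" by (simp add: mem_rtrans)
        then show "x \<in> A \<star> {s}" using B_Inter A0_sub by (auto simp: mem_rtrans)
      qed
      show "A \<star> {s} \<in> sets \<nu>" using A(1) by (simp add: nu_borel borel_rtrans)
    qed simp
    also have "\<dots> \<le> emeasure m S * \<kappa>" by (intro mult_left_mono kappa) simp
    finally show ?thesis unfolding S_def .
  qed simp
  show thesis
  proof (rule that)
    show "compact (iv ` B 0)" by (intro compact_iv B_compact)
    have "A0 \<noteq> {}" using m_A0 A(2) by auto
    then show "iv ` B 0 \<noteq> {}" using A0_B[of 0] by auto
  qed (rule main)
qed

end

section \<open>The Hahn-Banach theorem\<close>

definition fun_subspace :: "('b \<Rightarrow> real) set \<Rightarrow> bool" where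
  "fun_subspace V \<longleftrightarrow> (\<lambda>x. 0) \<in> V \<and> (\<forall>f\<in>V. \<forall>g\<in>V. (\<lambda>x. f x + g x) \<in> V) \<and>
     (\<forall>f\<in>V. \<forall>c. (\<lambda>x. c * f x) \<in> V)"

definition sublinear_on :: "('b \<Rightarrow> real) set \<Rightarrow> (('b \<Rightarrow> real) \<Rightarrow> real) \<Rightarrow> bool" where
  "sublinear_on V p \<longleftrightarrow> (\<forall>f\<in>V. \<forall>g\<in>V. p (\<lambda>x. f x + g x) \<le> p f + p g) \<and>
     (\<forall>f\<in>V. \<forall>c\<ge>0. p (\<lambda>x. c * f x) = c * p f)"

definition linear_form_on :: "('b \<Rightarrow> real) set \<Rightarrow> (('b \<Rightarrow> real) \<Rightarrow> real) \<Rightarrow> bool" where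
  "linear_form_on V h \<longleftrightarrow> (\<forall>f\<in>V. \<forall>g\<in>V. h (\<lambda>x. f x + g x) = h f + h g) \<and>
     (\<forall>f\<in>V. \<forall>c. h (\<lambda>x. c * f x) = c * h f)"

text \<open>Write \<open>g\<close> as the sum of \<open>g + f\<close> and \<open>-f\<close>. The
  bound keeps the infima finite, both along chains and in the lowering construction.\<close>

lemma sublinear_on_lower:
  assumes "fun_subspace V" "sublinear_on V q" "f \<in> V" "g \<in> V"
  shows "q g - q (\<lambda>x. -1 * f x) \<le> q (\<lambda>x. g x + f x)"
proof -
  have mem: "(\<lambda>x. g x + f x) \<in> V" "(\<lambda>x. -1 * f x) \<in> V"
    using assms unfolding fun_subspace_def by blast+
  have "q (\<lambda>x. (g x + f x) + -1 * f x) \<le> q (\<lambda>x. g x + f x) + q (\<lambda>x. -1 * f x)"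
    using assms(2) mem unfolding sublinear_on_def by (elim conjE) (drule (1) bspec, drule (1) bspec, simp)
  then show ?thesis by simp
qed

lemma sublinear_on_zero:
  assumes "fun_subspace V" "sublinear_on V q"
  shows "q (\<lambda>x. 0) = 0"
proof -
  have "(\<lambda>x. 0) \<in> V" using assms(1) by (simp add: fun_subspace_def)
  moreover have "\<forall>f\<in>V. \<forall>c\<ge>0. q (\<lambda>x. c * f x) = c * q f"
    using assms(2) by (simp add: sublinear_on_def)
  ultimately have "\<forall>c\<ge>0. q (\<lambda>x. c * 0) = c * q (\<lambda>x. 0)" by (drule_tac bspec)
  from this[rule_format, of 0] show ?thesis by simp
qed

text \<open>A minimal sublinear functional below \<^term>\<open>p\<close> is linear: otherwise it could be lowered to
  \<open>y \<mapsto> inf\<^sub>t (q (y + t x) - t q x)\<close>.\<close>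

theorem hahn_banach:
  fixes V :: "('b \<Rightarrow> real) set"
  assumes V: "fun_subspace V" and p: "sublinear_on V p"
  obtains h where "linear_form_on V h" "\<And>f. f \<in> V \<Longrightarrow> h f \<le> p f"
proof -
  have V0: "(\<lambda>x. 0) \<in> V" and Vadd: "\<And>f g. f \<in> V \<Longrightarrow> g \<in> V \<Longrightarrow> (\<lambda>x. f x + g x) \<in> V"
    and Vscale: "\<And>f c. f \<in> V \<Longrightarrow> (\<lambda>x. c * f x) \<in> V"
    using V unfolding fun_subspace_def by blast+
  \<comment> \<open>Off \<open>V\<close> the values are pinned to \<open>p\<close>, so that the
    pointwise order on total functions compares only values on \<open>V\<close> and minimality gives
    equality of functions.\<close>
  define A where "A = {q. sublinear_on V q \<and> (\<forall>f\<in>V. q f \<le> p f) \<and> (\<forall>f. f \<notin> V \<longrightarrow> q f = p f)}"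
  have lower: "- p (\<lambda>x. -1 * f x) \<le> q f" if "q \<in> A" "f \<in> V" for q f
  proof -
    have q: "sublinear_on V q" using that by (simp add: A_def)
    have "q (\<lambda>x. 0) - q (\<lambda>x. -1 * f x) \<le> q (\<lambda>x. 0 + f x)"
      by (rule sublinear_on_lower[OF V q that(2) V0])
    moreover have "q (\<lambda>x. -1 * f x) \<le> p (\<lambda>x. -1 * f x)"
      using that(1) Vscale[OF that(2)] unfolding A_def by blast
    ultimately show ?thesis using sublinear_on_zero[OF V q] by simp
  qed
  have "\<exists>q\<in>A. \<forall>r\<in>A. r \<le> q \<longrightarrow> r = q"
  proof (rule predicate_Zorn)
    show "partial_order_on A (relation_of (\<lambda>q r. r \<le> q) A)"
      by (rule partial_order_on_relation_ofI) auto
    fix C assume C: "C \<in> Chains (relation_of (\<lambda>q r. r \<le> q) A)"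
    show "\<exists>u\<in>A. \<forall>a\<in>C. u \<le> a"
    proof (cases "C = {}")
      case True
      have "p \<in> A" using p by (simp add: A_def)
      then show ?thesis using True by blast
    next
      case False
      have CA: "C \<subseteq> A" using C by (auto simp: Chains_def relation_of_def)
      have chain: "q \<le> r \<or> r \<le> q" if "q \<in> C" "r \<in> C" for q r
        using C that by (auto simp: Chains_def relation_of_def)
      define u where "u f = (INF q\<in>C. q f)" for f
      have bdd: "bdd_below ((\<lambda>q. q f) ` C)" for f
      proof (cases "f \<in> V")
        case True
        then show ?thesis using lower CA by (intro bdd_belowI2[of _ "- p (\<lambda>x. -1 * f x)"]) auto
      next
        case False
        then show ?thesis using CA by (intro bdd_belowI2[of _ "p f"]) (auto simp: A_def)
      qed
      have u_le: "u f \<le> q f" if "q \<in> C" for q f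
        unfolding u_def using bdd that by (rule cINF_lower)
      have u_ge: "b \<le> u f" if "\<And>q. q \<in> C \<Longrightarrow> b \<le> q f" for b f
        unfolding u_def using False that by (rule cINF_greatest)
      have sub: "q (\<lambda>x. f x + g x) \<le> q f + q g" "c \<ge> 0 \<Longrightarrow> q (\<lambda>x. c * f x) = c * q f"
        if "q \<in> C" "f \<in> V" "g \<in> V" for q f g c
        using that CA unfolding A_def sublinear_on_def by blast+
      have "u (\<lambda>x. f x + g x) \<le> u f + u g" if fg: "f \<in> V" "g \<in> V" for f g
      proof -
        \<comment> \<open>In a chain the smaller of \<open>q\<close> and \<open>r\<close> bounds
          both summands; taking the infimum in \<open>q\<close> and \<open>r\<close> separately then
          gives subadditivity.\<close>
        have *: "u (\<lambda>x. f x + g x) \<le> q f + r g" if qr: "q \<in> C" "r \<in> C" for q r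
        proof -
          obtain s where s: "s \<in> C" "s \<le> q" "s \<le> r" using chain[OF qr] qr by blast
          have "u (\<lambda>x. f x + g x) \<le> s (\<lambda>x. f x + g x)" by (rule u_le[OF s(1)])
          also have "\<dots> \<le> s f + s g" by (rule sub(1)[OF s(1) fg])
          also have "\<dots> \<le> q f + r g" using s by (intro add_mono) (auto simp: le_fun_def)
          finally show ?thesis .
        qed
        have "u (\<lambda>x. f x + g x) - r g \<le> u f" if "r \<in> C" for r
          using *[OF _ that] by (intro u_ge) (simp add: algebra_simps)
        then have "u (\<lambda>x. f x + g x) - u f \<le> u g" by (intro u_ge) (simp add: algebra_simps)
        then show ?thesis by simp
      qed
      moreover have "u (\<lambda>x. c * f x) = c * u f" if f: "f \<in> V" and c: "c \<ge> 0" for f c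
      proof (rule antisym)
        show "c * u f \<le> u (\<lambda>x. c * f x)"
        proof (rule u_ge)
          fix q assume q: "q \<in> C"
          show "c * u f \<le> q (\<lambda>x. c * f x)"
            using u_le[OF q, of f] sub(2)[OF q f f c] c by (simp add: mult_left_mono)
        qed
        show "u (\<lambda>x. c * f x) \<le> c * u f"
        proof (cases "c = 0")
          case True
          obtain q where q: "q \<in> C" using False by blast
          show ?thesis using u_le[OF q, of "\<lambda>x. c * f x"] sub(2)[OF q f f c] True by simp
        next
          case False
          have "u (\<lambda>x. c * f x) / c \<le> u f"
          proof (rule u_ge)
            fix q assume q: "q \<in> C"
            show "u (\<lambda>x. c * f x) / c \<le> q f"
              using u_le[OF q, of "\<lambda>x. c * f x"] sub(2)[OF q f f c] c False
              by (simp add: divide_le_eq mult.commute)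
          qed
          then show ?thesis using c False by (simp add: divide_le_eq mult.commute)
        qed
      qed
      ultimately have "sublinear_on V u" by (simp add: sublinear_on_def)
      moreover obtain q where q: "q \<in> C" using False by blast
      have "u f \<le> p f" if "f \<in> V" for f
        using u_le[OF q, of f] q CA that by (auto simp: A_def intro: order_trans)
      moreover have "u f = p f" if "f \<notin> V" for f
      proof -
        have "q' f = p f" if "q' \<in> C" for q' using CA that \<open>f \<notin> V\<close> unfolding A_def by blast
        then have "u f = (INF q\<in>C. p f)" unfolding u_def by (intro INF_cong) auto
        then show ?thesis using False by simp
      qed
      ultimately have "u \<in> A" by (simp add: A_def)
      then show ?thesis using u_le by (auto simp: le_fun_def)
    qed
  qed
  then obtain h where hA: "h \<in> A" and min: "\<And>r. r \<in> A \<Longrightarrow> r \<le> h \<Longrightarrow> r = h" by blast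
  have h: "sublinear_on V h" using hA by (simp add: A_def)
  then have hsub: "h (\<lambda>x. f x + g x) \<le> h f + h g" if "f \<in> V" "g \<in> V" for f g
    using that by (simp add: sublinear_on_def)
  have hscale: "h (\<lambda>x. c * f x) = c * h f" if "f \<in> V" "c \<ge> 0" for f c
    using that h by (simp add: sublinear_on_def)
  have add: "h (\<lambda>x. y x + g x) = h y + h g" if g: "g \<in> V" and y: "y \<in> V" for g y
  proof -
    define S where "S f = (\<lambda>t. h (\<lambda>x. f x + t * g x) - t * h g) ` {0..}" for f
    define r where "r f = (if f \<in> V then Inf (S f) else p f)" for f
    have lb: "- h (\<lambda>x. -1 * f x) \<le> h (\<lambda>x. f x + t * g x) - t * h g" if "f \<in> V" "t \<ge> 0" for f t
      using sublinear_on_lower[OF V h that(1) Vscale[OF g, of t]] hscale[OF g that(2)]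
      by (simp add: add.commute)
    have bdd: "bdd_below (S f)" if "f \<in> V" for f
      unfolding S_def using lb[OF that] by (intro bdd_belowI2[of _ "- h (\<lambda>x. -1 * f x)"]) auto
    have r_le: "r f \<le> h (\<lambda>x. f x + t * g x) - t * h g" if "f \<in> V" "t \<ge> 0" for f t
      unfolding r_def using bdd[OF that(1)] that by (auto simp: S_def intro!: cInf_lower)
    have r_ge: "b \<le> r f" if "f \<in> V" "\<And>t. t \<ge> 0 \<Longrightarrow> b \<le> h (\<lambda>x. f x + t * g x) - t * h g" for b f
      using that by (auto simp: r_def S_def intro!: cInf_greatest)
    have rh: "r f \<le> h f" if "f \<in> V" for f using r_le[OF that, of 0] by simp
    have "r (\<lambda>x. f x + k x) \<le> r f + r k" if f: "f \<in> V" and k: "k \<in> V" for f k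
    proof -
      have *: "r (\<lambda>x. f x + k x) \<le> (h (\<lambda>x. f x + t * g x) - t * h g) + (h (\<lambda>x. k x + s * g x) - s * h g)"
        if "t \<ge> 0" "s \<ge> 0" for t s
      proof -
        have "r (\<lambda>x. f x + k x) \<le> h (\<lambda>x. (f x + k x) + (t + s) * g x) - (t + s) * h g"
          using that by (intro r_le Vadd f k) auto
        also have "(\<lambda>x. (f x + k x) + (t + s) * g x) = (\<lambda>x. (f x + t * g x) + (k x + s * g x))"
          by (auto simp: algebra_simps)
        also have "h \<dots> \<le> h (\<lambda>x. f x + t * g x) + h (\<lambda>x. k x + s * g x)"
          by (intro hsub Vadd Vscale f k g)
        finally show ?thesis by (simp add: algebra_simps)
      qed
      have "r (\<lambda>x. f x + k x) - (h (\<lambda>x. k x + s * g x) - s * h g) \<le> r f" if "s \<ge> 0" for s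
        using *[OF _ that] by (intro r_ge f) (simp add: algebra_simps)
      then have "r (\<lambda>x. f x + k x) - r f \<le> r k" by (intro r_ge k) (simp add: algebra_simps)
      then show ?thesis by simp
    qed
    moreover have "r (\<lambda>x. c * f x) = c * r f" if f: "f \<in> V" and c: "c \<ge> 0" for f c
    proof (cases "c = 0")
      case True
      have "0 \<le> r (\<lambda>x. 0)" using hscale[OF g] by (intro r_ge V0) simp
      moreover have "r (\<lambda>x. 0) \<le> 0" using rh[OF V0] sublinear_on_zero[OF V h] by simp
      ultimately show ?thesis using True by simp
    next
      case False
      then have c: "c > 0" using c by simp
      \<comment> \<open>The substitution of \<open>t / c\<close> for \<open>t\<close> maps the
        half-line onto itself, so the infimum scales by \<open>c\<close>.\<close>
      have *: "h (\<lambda>x. c * f x + t * g x) - t * h g = c * (h (\<lambda>x. f x + (t / c) * g x) - (t / c) * h g)" for t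
      proof -
        have "(\<lambda>x. c * f x + t * g x) = (\<lambda>x. c * (f x + (t / c) * g x))"
          using c by (auto simp: field_simps)
        then show ?thesis using c
          hscale[OF Vadd[OF f Vscale[OF g, of "t / c"]], of c] by (simp add: field_simps)
      qed
      show ?thesis
      proof (rule antisym)
        show "c * r f \<le> r (\<lambda>x. c * f x)"
        proof (rule r_ge[OF Vscale[OF f]])
          fix t :: real assume "t \<ge> 0"
          then show "c * r f \<le> h (\<lambda>x. c * f x + t * g x) - t * h g"
            unfolding * using c r_le[OF f, of "t / c"] by (intro mult_left_mono) auto
        qed
        have "r (\<lambda>x. c * f x) / c \<le> r f"
        proof (rule r_ge[OF f])
          fix t :: real assume "t \<ge> 0"
          then have "r (\<lambda>x. c * f x) \<le> c * (h (\<lambda>x. f x + t * g x) - t * h g)"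
            using r_le[OF Vscale[OF f], of "c * t" c] *[of "c * t"] c by simp
          then show "r (\<lambda>x. c * f x) / c \<le> h (\<lambda>x. f x + t * g x) - t * h g"
            using c by (simp add: divide_le_eq mult.commute)
        qed
        then show "r (\<lambda>x. c * f x) \<le> c * r f" using c by (simp add: divide_le_eq mult.commute)
      qed
    qed
    ultimately have "sublinear_on V r" by (simp add: sublinear_on_def)
    moreover have "r f \<le> p f" if "f \<in> V" for f using rh[OF that] hA that by (force simp: A_def)
    ultimately have "r \<in> A" by (simp add: A_def r_def)
    moreover have "r \<le> h" unfolding le_fun_def
    proof
      show "r f \<le> h f" for f using rh[of f] hA by (cases "f \<in> V") (auto simp: r_def A_def)
    qed
    ultimately have "r = h" by (rule min)
    \<comment> \<open>Taking \<open>t = 1\<close> in the infimum gives superadditivity.\<close>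
    then have "h y \<le> h (\<lambda>x. y x + g x) - h g" using r_le[OF y, of 1] by simp
    then show ?thesis using hsub[OF y g] by simp
  qed
  have "h (\<lambda>x. c * f x) = c * h f" if f: "f \<in> V" for f c
  proof (cases "c \<ge> 0")
    case False
    have "h (\<lambda>x. c * f x + (- c) * f x) = h (\<lambda>x. c * f x) + h (\<lambda>x. (- c) * f x)"
      by (intro add Vscale f)
    then show ?thesis using hscale[OF f, of "- c"] False sublinear_on_zero[OF V h] by simp
  qed (rule hscale[OF f])
  then have "linear_form_on V h" using add by (simp add: linear_form_on_def)
  moreover have "h f \<le> p f" if "f \<in> V" for f using hA that by (simp add: A_def)
  ultimately show thesis by (rule that)
qed

section \<open>Continuous functions with compact support\<close>

definition Cc :: "('a::topological_space \<Rightarrow> real) set" where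
  "Cc = {f. continuous_on UNIV f \<and> (\<exists>K. compact K \<and> (\<forall>x. x \<notin> K \<longrightarrow> f x = 0))}"

lemma Cc_cont: "f \<in> Cc \<Longrightarrow> continuous_on UNIV f"
  by (simp add: Cc_def)

lemma Cc_supp: "f \<in> Cc \<Longrightarrow> \<exists>K. compact K \<and> (\<forall>x. x \<notin> K \<longrightarrow> f x = 0)"
  by (simp add: Cc_def)

lemma CcI: "continuous_on UNIV f \<Longrightarrow> compact K \<Longrightarrow> (\<And>x. x \<notin> K \<Longrightarrow> f x = 0) \<Longrightarrow> f \<in> Cc"
  by (auto simp: Cc_def)

lemma Cc_zero: "(\<lambda>x. 0) \<in> Cc"
  by (rule CcI[of _ "{}"]) auto

lemma Cc_scale: assumes "f \<in> Cc" shows "(\<lambda>x. c * f x) \<in> Cc"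
proof -
  obtain K where "compact K" "\<And>x. x \<notin> K \<Longrightarrow> f x = 0" using Cc_supp[OF assms] by blast
  then show ?thesis
    by (intro CcI[of _ K]) (auto intro!: continuous_intros Cc_cont[OF assms])
qed

lemma Cc_abs: assumes "f \<in> Cc" shows "(\<lambda>x. \<bar>f x\<bar>) \<in> Cc"
proof -
  obtain K where "compact K" "\<And>x. x \<notin> K \<Longrightarrow> f x = 0" using Cc_supp[OF assms] by blast
  then show ?thesis
    by (intro CcI[of _ K]) (auto intro!: continuous_intros Cc_cont[OF assms])
qed

lemma Cc_add: assumes "f \<in> Cc" "g \<in> Cc" shows "(\<lambda>x. f x + g x) \<in> Cc"
proof -
  obtain K L where "compact K" "\<And>x. x \<notin> K \<Longrightarrow> f x = 0" "compact L" "\<And>x. x \<notin> L \<Longrightarrow> g x = 0"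
    using Cc_supp[OF assms(1)] Cc_supp[OF assms(2)] by metis
  then show ?thesis
    by (intro CcI[OF continuous_on_add[OF Cc_cont[OF assms(1)] Cc_cont[OF assms(2)]] compact_Un, of K L]) auto
qed

lemma Cc_diff: "f \<in> Cc \<Longrightarrow> g \<in> Cc \<Longrightarrow> (\<lambda>x. f x - g x) \<in> Cc"
  using Cc_add[of f "\<lambda>x. -1 * g x"] Cc_scale[of g "-1"] by simp

lemma Cc_sum: "(\<And>i. i \<in> J \<Longrightarrow> f i \<in> Cc) \<Longrightarrow> (\<lambda>x. \<Sum>i\<in>J. f i x) \<in> Cc"
  by (induction J rule: infinite_finite_induct) (auto intro: Cc_zero Cc_add)

lemma Cc_subspace: "fun_subspace Cc"
  by (simp add: fun_subspace_def Cc_zero Cc_add Cc_scale)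

lemma linear_form_sum:
  assumes V: "fun_subspace V" and h: "linear_form_on V h" and f: "\<And>i. i \<in> J \<Longrightarrow> f i \<in> V"
  shows "h (\<lambda>x. \<Sum>i\<in>J. c i * f i x) = (\<Sum>i\<in>J. c i * h (f i))"
proof -
  have V0: "(\<lambda>x. 0) \<in> V" and Vadd: "\<And>f g. f \<in> V \<Longrightarrow> g \<in> V \<Longrightarrow> (\<lambda>x. f x + g x) \<in> V"
    and Vscale: "\<And>f c. f \<in> V \<Longrightarrow> (\<lambda>x. c * f x) \<in> V"
    using V unfolding fun_subspace_def by blast+
  have add: "\<And>f g. f \<in> V \<Longrightarrow> g \<in> V \<Longrightarrow> h (\<lambda>x. f x + g x) = h f + h g"
    and scale: "\<And>f c. f \<in> V \<Longrightarrow> h (\<lambda>x. c * f x) = c * h f"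
    using h unfolding linear_form_on_def by blast+
  have h0: "h (\<lambda>x. 0) = 0" using scale[OF V0, of 0] by simp
  have "(\<lambda>x. \<Sum>i\<in>J. c i * f i x) \<in> V \<and> h (\<lambda>x. \<Sum>i\<in>J. c i * f i x) = (\<Sum>i\<in>J. c i * h (f i))"
    using f
  proof (induction J rule: infinite_finite_induct)
    case (insert i J)
    have i: "f i \<in> V" using insert.prems by simp
    have J: "(\<lambda>x. \<Sum>i\<in>J. c i * f i x) \<in> V" "h (\<lambda>x. \<Sum>i\<in>J. c i * f i x) = (\<Sum>i\<in>J. c i * h (f i))"
      using insert.IH insert.prems by simp_all
    have eq: "(\<lambda>x. \<Sum>i\<in>insert i J. c i * f i x) = (\<lambda>x. c i * f i x + (\<Sum>i\<in>J. c i * f i x))"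
      using insert.hyps by simp
    have "h (\<lambda>x. c i * f i x + (\<Sum>i\<in>J. c i * f i x)) = c i * h (f i) + (\<Sum>i\<in>J. c i * h (f i))"
      using add[OF Vscale[OF i] J(1), of "c i"] scale[OF i, of "c i"] J(2) by argo
    then show ?case
      unfolding eq using Vadd[OF Vscale[OF i] J(1), of "c i"] by (simp only: sum.insert[OF insert.hyps])
  qed (simp_all add: V0 h0)
  then show ?thesis ..
qed

context unimodular_lc_group
begin

section \<open>Translation and integration of compactly supported functions\<close>

lemma Cc_rtrans: assumes "f \<in> Cc" shows "(\<lambda>x. f (x \<cdot> t)) \<in> Cc"
proof -
  obtain K where K: "compact K" "\<And>x. x \<notin> K \<Longrightarrow> f x = 0" using Cc_supp[OF assms] by blast
  show ?thesis
  proof (rule CcI)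
    show "compact (K \<star> {iv t})" by (intro compact_setmul K) auto
    show "f (x \<cdot> t) = 0" if "x \<notin> K \<star> {iv t}" for x using that K(2) by (simp add: mem_rtrans)
    show "continuous_on UNIV (\<lambda>x. f (x \<cdot> t))"
      by (rule continuous_on_compose2[OF Cc_cont[OF assms]]) (auto intro!: continuous_intros)
  qed
qed

lemma Cc_ltrans: assumes "f \<in> Cc" shows "(\<lambda>x. f (t \<cdot> x)) \<in> Cc"
proof -
  obtain K where K: "compact K" "\<And>x. x \<notin> K \<Longrightarrow> f x = 0" using Cc_supp[OF assms] by blast
  show ?thesis
  proof (rule CcI)
    show "compact ({iv t} \<star> K)" by (intro compact_setmul K) auto
    show "f (t \<cdot> x) = 0" if "x \<notin> {iv t} \<star> K" for x using that K(2) by (simp add: mem_ltrans)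
    show "continuous_on UNIV (\<lambda>x. f (t \<cdot> x))"
      by (rule continuous_on_compose2[OF Cc_cont[OF assms]]) (auto intro!: continuous_intros)
  qed
qed

lemma Cc_iv: assumes "f \<in> Cc" shows "(\<lambda>x. f (iv x)) \<in> Cc"
proof -
  obtain K where K: "compact K" "\<And>x. x \<notin> K \<Longrightarrow> f x = 0" using Cc_supp[OF assms] by blast
  show ?thesis
  proof (rule CcI)
    show "compact (iv ` K)" by (intro compact_iv K)
    show "f (iv x) = 0" if "x \<notin> iv ` K" for x using that K(2) by (simp add: mem_iv_image)
    show "continuous_on UNIV (\<lambda>x. f (iv x))"
      by (rule continuous_on_compose2[OF Cc_cont[OF assms]]) (auto intro!: continuous_intros)
  qed
qed

lemma Cc_measurable: "f \<in> Cc \<Longrightarrow> f \<in> borel_measurable m"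
  using borel_measurable_continuous_onI[OF Cc_cont] by (simp cong: measurable_cong_sets)

lemma Cc_integrable: assumes "f \<in> Cc" shows "integrable m f"
proof -
  obtain K where K: "compact K" "\<And>x. x \<notin> K \<Longrightarrow> f x = 0" using Cc_supp[OF assms] by blast
  have "continuous_on K f" using Cc_cont[OF assms] by (rule continuous_on_subset) simp
  then have "bounded (f ` K)"
    using K(1) by (intro compact_imp_bounded compact_continuous_image)
  then obtain B where "\<And>x. x \<in> K \<Longrightarrow> norm (f x) \<le> B" unfolding bounded_iff by blast
  with K(2) show ?thesis
    using m_compact[OF K(1)] compact_borel[OF K(1)]
    by (intro integrableI_bounded_set[OF _ Cc_measurable[OF assms], of K B]) simp_all
qed

lemma measurable_rtrans: "(\<lambda>x. x \<cdot> t) \<in> measurable m m"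
proof -
  have "(\<lambda>x. x \<cdot> t) \<in> measurable borel borel"
    by (intro borel_measurable_continuous_onI continuous_intros)
  then show ?thesis using measurable_cong_sets[OF sets_m sets_m] by blast
qed

lemma measurable_ltrans: "(\<lambda>x. t \<cdot> x) \<in> measurable m m"
proof -
  have "(\<lambda>x. t \<cdot> x) \<in> measurable borel borel"
    by (intro borel_measurable_continuous_onI continuous_intros)
  then show ?thesis using measurable_cong_sets[OF sets_m sets_m] by blast
qed

lemma distr_rtrans: "distr m m (\<lambda>x. x \<cdot> t) = m"
proof (rule measure_eqI)
  fix A assume "A \<in> sets (distr m m (\<lambda>x. x \<cdot> t))"
  then have A: "A \<in> sets borel" by simp
  have "(\<lambda>x. x \<cdot> t) -` A = A \<star> {iv t}" by (auto simp: mem_rtrans)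
  then show "emeasure (distr m m (\<lambda>x. x \<cdot> t)) A = emeasure m A"
    using A by (simp add: emeasure_distr measurable_rtrans m_rtrans)
qed simp

lemma distr_ltrans: "distr m m (\<lambda>x. t \<cdot> x) = m"
proof (rule measure_eqI)
  fix A assume "A \<in> sets (distr m m (\<lambda>x. t \<cdot> x))"
  then have A: "A \<in> sets borel" by simp
  have "(\<lambda>x. t \<cdot> x) -` A = {iv t} \<star> A" by (auto simp: mem_ltrans)
  then show "emeasure (distr m m (\<lambda>x. t \<cdot> x)) A = emeasure m A"
    using A by (simp add: emeasure_distr measurable_ltrans m_ltrans)
qed simp

lemma integral_rtrans: assumes "f \<in> Cc" shows "(\<integral>x. f (x \<cdot> t) \<partial>m) = (\<integral>x. f x \<partial>m)"
  using integral_distr[OF measurable_rtrans Cc_measurable[OF assms]] by (simp add: distr_rtrans)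

lemma integral_ltrans: assumes "f \<in> Cc" shows "(\<integral>x. f (t \<cdot> x) \<partial>m) = (\<integral>x. f x \<partial>m)"
  using integral_distr[OF measurable_ltrans Cc_measurable[OF assms]] by (simp add: distr_ltrans)

section \<open>Urysohn functions and uniform continuity\<close>

text \<open>A locally compact Hausdorff space is completely regular, which separates
  \<open>K\<close> from the complement of the open set \<open>W\<close>. As \<open>W\<close> lies in
  the compact set \<open>K \<star> C\<close> inside \<open>U\<close>, the separating function has
  compact support.\<close>

lemma urysohn:
  fixes K :: "'a set"
  assumes "compact K" "open U" "K \<subseteq> U"
  obtains f where "f \<in> Cc" "\<And>x. 0 \<le> f x" "\<And>x. x \<in> K \<Longrightarrow> f x = 1" "\<And>x. x \<notin> U \<Longrightarrow> f x = 0"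
proof -
  obtain V where V: "open V" "e \<in> V" "K \<star> V \<subseteq> U" using tube[OF assms] by metis
  obtain C where C: "compact C" "e \<in> interior C" "C \<star> C \<subseteq> V" using compact_nhd[OF V(1,2)] by metis
  have CV: "C \<subseteq> V"
  proof
    fix x assume "x \<in> C"
    then have "e \<cdot> x \<in> C \<star> C" using C(2) interior_subset by blast
    then show "x \<in> V" using C(3) by auto
  qed
  define W where "W = (\<Union>k\<in>K. {k} \<star> interior C)"
  have "open W" unfolding W_def by (intro open_UN ballI open_ltrans) auto
  have "K \<subseteq> W" unfolding W_def using C(2) by (auto simp: mem_ltrans)
  have WKC: "W \<subseteq> K \<star> C"
    unfolding W_def using interior_subset[of C] setmul_mono[of "{_}" K "interior C" C] by blast
  have "locally compact (UNIV :: 'a set)" using lc by (simp add: lc_group_def)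
  then have "\<exists>U K. open U \<and> compact K \<and> x \<in> U \<and> U \<subseteq> K" for x :: 'a
    unfolding locally_def by (elim allE[of _ UNIV] allE[of _ x]) auto
  then have lcs: "locally_compact_space (euclidean :: 'a topology)"
    unfolding locally_compact_space_def by simp
  have "Hausdorff_space (euclidean :: 'a topology)"
    unfolding Hausdorff_space_def using hausdorff by (simp add: disjnt_def) blast
  then have "completely_regular_space (euclidean :: 'a topology)"
    using lcs by (simp add: locally_compact_regular_imp_completely_regular_space
        locally_compact_Hausdorff_imp_regular_space)
  then obtain f where f: "continuous_map euclidean (top_of_set {0..1::real}) f"
      "f ` (- W) \<subseteq> {0}" "f ` K \<subseteq> {1}"
    using Urysohn_completely_regular_compact_closed[of 0 1 euclidean K "- W"] assms(1) \<open>open W\<close> \<open>K \<subseteq> W\<close>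
    by (auto simp: disjnt_def closed_Compl)
  show thesis
  proof (rule that)
    show "f \<in> Cc"
    proof (rule CcI)
      show "continuous_on UNIV f" using f(1) by (simp add: continuous_map_in_subtopology)
      show "compact (K \<star> C)" by (intro compact_setmul assms C)
      show "f x = 0" if "x \<notin> K \<star> C" for x using that WKC f(2) by blast
    qed
    show "0 \<le> f x" for x using f(1) by (auto simp: continuous_map_in_subtopology Pi_iff)
    show "f x = 1" if "x \<in> K" for x using f(3) that by blast
    show "f x = 0" if "x \<notin> U" for x
    proof -
      have "K \<star> C \<subseteq> U" using setmul_mono[OF order_refl CV, of K] V(3) by blast
      then show ?thesis using that WKC f(2) by blast
    qed
  qed
qed

text \<open>The tube lemma controls \<open>x\<close> in a compact set only. Outside
  \<open>K \<star> C\<close>, with \<open>C\<close> symmetric, both \<open>x\<close> and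
  \<open>x \<cdot> v\<close> avoid \<open>K\<close>, so the difference vanishes; likewise on the
  other side.\<close>

lemma unif_cont:
  assumes f: "f \<in> Cc" and c: "c > 0"
  obtains V where "open V" "e \<in> V" "\<And>v x. v \<in> V \<Longrightarrow> \<bar>f (x \<cdot> v) - f x\<bar> < c"
    "\<And>v x. v \<in> V \<Longrightarrow> \<bar>f (v \<cdot> x) - f x\<bar> < c"
proof -
  obtain K where K: "compact K" "\<And>x. x \<notin> K \<Longrightarrow> f x = 0" using Cc_supp[OF f] by blast
  obtain C where C: "compact C" "e \<in> interior C" "\<And>x. x \<in> C \<Longrightarrow> iv x \<in> C"
    using compact_nhd[OF open_UNIV UNIV_I] by metis
  have eC: "e \<in> C" using C(2) interior_subset by blast
  have S1: "compact (K \<star> C)" and S2: "compact (C \<star> K)" using K C by (auto intro: compact_setmul)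
  have co: "continuous_on UNIV (\<lambda>x. f (g x))" if "continuous_on UNIV g" for g :: "'a \<times> 'a \<Rightarrow> 'a"
    by (rule continuous_on_compose2[OF Cc_cont[OF f] that]) auto
  have o1: "open {p. \<bar>f (snd p \<cdot> fst p) - f (snd p)\<bar> < c}" and o2: "open {p. \<bar>f (fst p \<cdot> snd p) - f (snd p)\<bar> < c}"
    by (intro open_Collect_less continuous_intros co)+
  have "{e} \<times> (K \<star> C) \<subseteq> {p. \<bar>f (snd p \<cdot> fst p) - f (snd p)\<bar> < c}" using c by auto
  from Elementary_Topology.tube_lemma[OF S1 o1 this] obtain V where
    V: "e \<in> V" "open V" "V \<times> (K \<star> C) \<subseteq> {p. \<bar>f (snd p \<cdot> fst p) - f (snd p)\<bar> < c}" by (elim exE conjE)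
  have "{e} \<times> (C \<star> K) \<subseteq> {p. \<bar>f (fst p \<cdot> snd p) - f (snd p)\<bar> < c}" using c by auto
  from Elementary_Topology.tube_lemma[OF S2 o2 this] obtain W where
    W: "e \<in> W" "open W" "W \<times> (C \<star> K) \<subseteq> {p. \<bar>f (fst p \<cdot> snd p) - f (snd p)\<bar> < c}" by (elim exE conjE)
  show thesis
  proof (rule that)
    show "open (V \<inter> W \<inter> interior C)" "e \<in> V \<inter> W \<inter> interior C" using V W C by auto
    fix v x assume v: "v \<in> V \<inter> W \<inter> interior C"
    then have vC: "iv v \<in> C" using C(3) interior_subset by blast
    show "\<bar>f (x \<cdot> v) - f x\<bar> < c"
    proof (cases "x \<in> K \<star> C")
      case True
      then have "(v, x) \<in> V \<times> (K \<star> C)" using v by simp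
      then show ?thesis using V(3) by fastforce
    next
      case False
      have "x \<notin> K" using False setmulI[of x K e C] eC by auto
      moreover have "x \<cdot> v \<notin> K" using False setmulI[of "x \<cdot> v" K "iv v" C] vC by (auto simp: assoc)
      ultimately show ?thesis using K(2) c by simp
    qed
    show "\<bar>f (v \<cdot> x) - f x\<bar> < c"
    proof (cases "x \<in> C \<star> K")
      case True
      then have "(v, x) \<in> W \<times> (C \<star> K)" using v by simp
      then show ?thesis using W(3) by fastforce
    next
      case False
      have "x \<notin> K" using False setmulI[of e C x K] eC by auto
      moreover have "v \<cdot> x \<notin> K" using False setmulI[of "iv v" C "v \<cdot> x" K] vC by auto
      ultimately show ?thesis using K(2) c by simp
    qed
  qed
qed

section \<open>The L1 seminorm\<close>

definition L1 :: "('a \<Rightarrow> real) \<Rightarrow> real" where "L1 f = (\<integral>x. \<bar>f x\<bar> \<partial>m)"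

lemma L1_nonneg: "0 \<le> L1 f"
  by (simp add: L1_def)

lemma L1_scale: "L1 (\<lambda>x. c * f x) = \<bar>c\<bar> * L1 f"
  by (simp add: L1_def abs_mult)

lemma L1_add: "f \<in> Cc \<Longrightarrow> g \<in> Cc \<Longrightarrow> L1 (\<lambda>x. f x + g x) \<le> L1 f + L1 g"
  unfolding L1_def
  by (subst Bochner_Integration.integral_add[symmetric, OF Cc_integrable[OF Cc_abs] Cc_integrable[OF Cc_abs]])
     (auto intro!: integral_mono Bochner_Integration.integrable_add abs_triangle_ineq
        intro: Cc_integrable Cc_abs Cc_add)

lemma L1_rtrans: "f \<in> Cc \<Longrightarrow> L1 (\<lambda>x. f (x \<cdot> t)) = L1 f"
  unfolding L1_def by (rule integral_rtrans[OF Cc_abs])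

lemma L1_bound:
  assumes f: "f \<in> Cc" and S: "compact S" "\<And>x. x \<notin> S \<Longrightarrow> f x = 0" and c: "\<And>x. \<bar>f x\<bar> \<le> c"
  shows "L1 f \<le> c * measure m S"
proof -
  have "L1 f \<le> (\<integral>x. c * indicator S x \<partial>m)"
    unfolding L1_def
  proof (rule integral_mono)
    show "integrable m (\<lambda>x. c * indicator S x)"
      using S(1) m_compact[OF S(1)] by (intro integrable_mult_right integrable_real_indicator) auto
    show "\<bar>f x\<bar> \<le> c * indicator S x" for x using c[of x] S(2)[of x] by (cases "x \<in> S") auto
  qed (intro Cc_integrable Cc_abs f)
  also have "\<dots> = c * measure m S" by simp
  finally show ?thesis .
qed

text \<open>For \<open>v\<close> near \<open>e\<close> all the differences vanish off the same
  compact set \<open>K \<star> C\<close>, so uniform smallness integrates. This provides the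
  continuity of \<open>H f\<close> when the invariant mean is applied.\<close>

lemma L1_rtrans_small:
  assumes f: "f \<in> Cc" and c: "c > 0"
  obtains V where "open V" "e \<in> V" "\<And>v. v \<in> V \<Longrightarrow> L1 (\<lambda>x. f (x \<cdot> v) - f x) < c"
proof -
  obtain K where K: "compact K" "\<And>x. x \<notin> K \<Longrightarrow> f x = 0" using Cc_supp[OF f] by blast
  obtain C where C: "compact C" "e \<in> interior C" "\<And>x. x \<in> C \<Longrightarrow> iv x \<in> C"
    using compact_nhd[OF open_UNIV UNIV_I] by metis
  have eC: "e \<in> C" using C(2) interior_subset by blast
  define M where "M = measure m (K \<star> C)"
  have "c / (M + 1) > 0" using c by (simp add: M_def add_nonneg_pos)
  then obtain V where V: "open V" "e \<in> V" "\<And>v x. v \<in> V \<Longrightarrow> \<bar>f (x \<cdot> v) - f x\<bar> < c / (M + 1)"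
    using unif_cont[OF f] by metis
  have "L1 (\<lambda>x. f (x \<cdot> v) - f x) < c" if v: "v \<in> V \<inter> interior C" for v
  proof -
    have vC: "iv v \<in> C" using v C(3) interior_subset by blast
    have "L1 (\<lambda>x. f (x \<cdot> v) - f x) \<le> c / (M + 1) * measure m (K \<star> C)"
    proof (rule L1_bound)
      show "(\<lambda>x. f (x \<cdot> v) - f x) \<in> Cc" by (intro Cc_diff Cc_rtrans f)
      show "compact (K \<star> C)" by (intro compact_setmul K C)
      show "\<bar>f (x \<cdot> v) - f x\<bar> \<le> c / (M + 1)" for x using V(3) v by (simp add: less_imp_le)
      fix x assume x: "x \<notin> K \<star> C"
      have "x \<notin> K" using x setmulI[of x K e C] eC by auto
      moreover have "x \<cdot> v \<notin> K" using x setmulI[of "x \<cdot> v" K "iv v" C] vC by (auto simp: assoc)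
      ultimately show "f (x \<cdot> v) - f x = 0" using K(2) by simp
    qed
    also have "\<dots> < c"
    proof -
      have "M \<ge> 0" by (simp add: M_def)
      then show ?thesis using c by (simp add: M_def[symmetric] field_simps)
    qed
    finally show ?thesis .
  qed
  moreover have "open (V \<inter> interior C)" "e \<in> V \<inter> interior C" using V C by auto
  ultimately show thesis using that by metis
qed

lemma integral_pos:
  assumes f: "f \<in> Cc" "\<And>x. 0 \<le> f x" and "f a > 0"
  shows "0 < (\<integral>x. f x \<partial>m)"
proof (rule ccontr)
  assume "\<not> ?thesis"
  moreover have "0 \<le> (\<integral>x. f x \<partial>m)" using f(2) by simp
  ultimately have "(\<integral>x. f x \<partial>m) = 0" by simp
  then have "AE x in m. f x = 0"
    using integral_nonneg_eq_0_iff_AE[OF Cc_integrable[OF f(1)]] f(2) by simp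
  moreover have o: "open {x. f x > 0}"
    by (intro open_Collect_less continuous_intros Cc_cont f)
  moreover have "{x \<in> space m. f x \<noteq> 0} = {x. f x > 0}" using f(2) by (auto simp: less_le)
  ultimately have "emeasure m {x. f x > 0} = 0"
    by (subst (asm) AE_iff_measurable[OF _ refl]) auto
  then show False using m_open_pos[OF o] assms(3) by auto
qed

section \<open>Averages of right translates\<close>

text \<open>The operators \<open>f \<mapsto> f * \<mu>\<close> with \<open>\<mu>\<close> a positive combination of point masses, of total mass \<open>s\<close>.\<close>

inductive posop :: "real \<Rightarrow> (('a \<Rightarrow> real) \<Rightarrow> 'a \<Rightarrow> real) \<Rightarrow> bool" where
  transl: "posop 1 (\<lambda>f x. f (x \<cdot> iv t))"
| add: "posop s S \<Longrightarrow> posop t T \<Longrightarrow> posop (s + t) (\<lambda>f x. S f x + T f x)"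
| scale: "0 \<le> c \<Longrightarrow> posop s S \<Longrightarrow> posop (c * s) (\<lambda>f x. c * S f x)"
| comp: "posop s S \<Longrightarrow> posop t T \<Longrightarrow> posop (s * t) (\<lambda>f. S (T f))"

lemma posop_mass_nonneg: "posop s T \<Longrightarrow> 0 \<le> s"
  by (induction rule: posop.induct) auto

lemma posop_Cc: "posop s T \<Longrightarrow> f \<in> Cc \<Longrightarrow> T f \<in> Cc"
  by (induction arbitrary: f rule: posop.induct) (auto intro: Cc_rtrans Cc_add Cc_scale)

lemma posop_add: "posop s T \<Longrightarrow> T (\<lambda>x. f x + g x) = (\<lambda>x. T f x + T g x)"
  by (induction arbitrary: f g rule: posop.induct) (auto simp: algebra_simps)

lemma posop_scale: "posop s T \<Longrightarrow> T (\<lambda>x. c * f x) = (\<lambda>x. c * T f x)"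
  by (induction arbitrary: f rule: posop.induct) (auto simp: algebra_simps)

lemma posop_mono: "posop s T \<Longrightarrow> (\<And>x. f x \<le> g x) \<Longrightarrow> T f x \<le> T g x"
proof (induction arbitrary: f g x rule: posop.induct)
  case (comp s S t T)
  show ?case by (rule comp.IH(1)) (rule comp.IH(2)[OF comp.prems])
qed (auto intro: add_mono mult_left_mono)

text \<open>Left and right translations commute. This lets an inequality between left translates of
  \<phi> pass to left translates of its average.\<close>

lemma posop_ltrans: "posop s T \<Longrightarrow> T (\<lambda>x. f (k \<cdot> x)) = (\<lambda>x. T f (k \<cdot> x))"
  by (induction arbitrary: f rule: posop.induct) (auto simp: assoc)

lemma posop_L1: "posop s T \<Longrightarrow> f \<in> Cc \<Longrightarrow> L1 (T f) \<le> s * L1 f"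
proof (induction arbitrary: f rule: posop.induct)
  case (transl t)
  then show ?case by (simp add: L1_rtrans)
next
  case (add s S t T)
  have "L1 (\<lambda>x. S f x + T f x) \<le> L1 (S f) + L1 (T f)"
    by (intro L1_add posop_Cc[OF add.hyps(1)] posop_Cc[OF add.hyps(2)] add.prems)
  then show ?case using add.IH[OF add.prems] by (simp add: algebra_simps)
next
  case (scale c s S)
  then show ?case using scale.IH[OF scale.prems] by (simp add: L1_scale mult.assoc mult_left_mono)
next
  case (comp s S t T)
  have "L1 (S (T f)) \<le> s * L1 (T f)" by (intro comp.IH posop_Cc[OF comp.hyps(2)] comp.prems)
  also have "\<dots> \<le> s * (t * L1 f)"
    by (intro mult_left_mono comp.IH comp.prems posop_mass_nonneg[OF comp.hyps(1)])
  finally show ?case by (simp add: mult.assoc)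
qed

lemma posop_integral: "posop s T \<Longrightarrow> f \<in> Cc \<Longrightarrow> (\<integral>x. T f x \<partial>m) = s * (\<integral>x. f x \<partial>m)"
proof (induction arbitrary: f rule: posop.induct)
  case (transl t)
  then show ?case by (simp add: integral_rtrans)
next
  case (add s S t T)
  have "(\<integral>x. S f x + T f x \<partial>m) = (\<integral>x. S f x \<partial>m) + (\<integral>x. T f x \<partial>m)"
    by (intro Bochner_Integration.integral_add Cc_integrable
        posop_Cc[OF add.hyps(1)] posop_Cc[OF add.hyps(2)] add.prems)
  then show ?case using add.IH[OF add.prems] by (simp add: algebra_simps)
next
  case (scale c s S)
  then show ?case by simp
next
  case (comp s S t T)
  have "(\<integral>x. S (T f) x \<partial>m) = s * (\<integral>x. T f x \<partial>m)"
    by (intro comp.IH posop_Cc[OF comp.hyps(2)] comp.prems)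
  then show ?case using comp.IH(2)[OF comp.prems] by simp
qed

text \<open>Riemann sums of \<open>\<theta> * \<psi>\<close>, for a bump \<open>\<psi>\<close> near \<^term>\<open>e\<close>, approximate a multiple of \<open>\<theta>\<close> in \<open>L\<^sup>1\<close> by
  \<open>\<Sum>\<^sub>j b\<^sub>j \<psi>(x j\<inverse>)\<close> with \<open>\<Sum>\<^sub>j b\<^sub>j = \<integral>\<theta> = 0\<close>, on which an invariant functional vanishes.\<close>

lemma invariant_form_zero:
  assumes lin: "linear_form_on Cc I" and bound: "\<And>f. f \<in> Cc \<Longrightarrow> \<bar>I f\<bar> \<le> L1 f"
    and inv: "\<And>f t. f \<in> Cc \<Longrightarrow> I (\<lambda>x. f (x \<cdot> iv t)) = I f"
    and th: "\<theta> \<in> Cc" "(\<integral>x. \<theta> x \<partial>m) = 0"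
  shows "I \<theta> = 0"
proof -
  obtain S where S: "compact S" "\<And>x. x \<notin> S \<Longrightarrow> \<theta> x = 0" using Cc_supp[OF th(1)] by blast
  \<comment> \<open>\<open>C\<close> is fixed before \<epsilon>: every bump below is supported in
    \<open>C\<close>, so all approximation errors vanish off \<open>C \<star> S\<close> and
    \<open>M\<close> does not depend on \<epsilon>.\<close>
  obtain C where C: "compact C" "e \<in> interior C" using compact_nhd[OF open_UNIV UNIV_I] by metis
  define M where "M = measure m (C \<star> S)"
  have M: "M \<ge> 0" by (simp add: M_def)
  have main: "\<bar>I \<theta>\<bar> \<le> M * (1 + L1 \<theta>) * \<epsilon>" if eps: "\<epsilon> > 0" for \<epsilon>
  proof -
    obtain V where V: "open V" "e \<in> V" "\<And>v x. v \<in> V \<Longrightarrow> \<bar>\<theta> (v \<cdot> x) - \<theta> x\<bar> < \<epsilon>"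
      using unif_cont[OF th(1) eps] by metis
    obtain \<psi> where psi: "\<psi> \<in> Cc" "\<And>x. 0 \<le> \<psi> x" "\<psi> e = 1" "\<And>x. x \<notin> V \<inter> interior C \<Longrightarrow> \<psi> x = 0"
      by (rule urysohn[of "{e}" "V \<inter> interior C"]) (use V C in auto)
    \<comment> \<open>By right invariance \<open>c\<close> is the integral of
      \<open>\<psi> (z \<cdot> iv s)\<close> over \<open>s\<close> for every \<open>z\<close>, so
      \<open>c * \<theta> z\<close> is an integral that can be compared with the Riemann sum
      \<open>G z\<close>.\<close>
    define c where "c = (\<integral>s. \<psi> (iv s) \<partial>m)"
    have c: "c > 0" unfolding c_def
      by (rule integral_pos[OF Cc_iv[OF psi(1)], of e]) (simp_all add: psi)
    have Cc_psi: "(\<lambda>s. \<psi> (z \<cdot> iv s)) \<in> Cc" for z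
      using Cc_rtrans[OF Cc_iv[OF psi(1)], of "iv z"] by (simp add: inverse_distrib_swap)
    have int_psi: "(\<integral>s. \<psi> (z \<cdot> iv s) \<partial>m) = c" for z
      using integral_rtrans[OF Cc_iv[OF psi(1)], of "iv z"] by (simp add: inverse_distrib_swap c_def)
    \<comment> \<open>The tolerance carries the factor \<open>c\<close> because \<open>c\<close>
      depends on \<epsilon> through \<psi>; it cancels at the end.\<close>
    have "\<epsilon> * c > 0" using eps c by simp
    then obtain W where W: "open W" "e \<in> W" "\<And>v x. v \<in> W \<Longrightarrow> \<bar>\<psi> (x \<cdot> v) - \<psi> x\<bar> < \<epsilon> * c"
      using unif_cont[OF psi(1)] by metis
    obtain J B where J: "finite J" "J \<subseteq> S" "\<And>s. s \<in> J \<Longrightarrow> B s \<in> sets borel"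
      "\<And>s. s \<in> J \<Longrightarrow> B s \<subseteq> W \<star> {s}" "disjoint_family_on B J" "(\<Union>s\<in>J. B s) = S"
      by (rule borel_partition[OF S(1) W(1,2)]) blast
    define b where "b j = (\<integral>s. \<theta> s * indicator (B j) s \<partial>m)" for j
    have int_b: "integrable m (\<lambda>s. \<theta> s * indicator (B j) s)" if "j \<in> J" for j
      using J(3)[OF that] by (intro integrable_real_mult_indicator Cc_integrable th) simp
    define G where "G = (\<lambda>z. \<Sum>j\<in>J. b j * \<psi> (z \<cdot> iv j))"
    have G_Cc: "G \<in> Cc" unfolding G_def by (intro Cc_sum Cc_scale Cc_rtrans psi)
    have sum_ind: "(\<Sum>j\<in>J. \<theta> s * indicator (B j) s * k j) = \<theta> s * k i"
      if "i \<in> J" "s \<in> B i" for s i and k :: "'a \<Rightarrow> real"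
    proof -
      have "indicator (B j) s = (if j = i then 1 else 0 :: real)" if "j \<in> J" for j
      proof (cases "j = i")
        case False
        then have "B j \<inter> B i = {}" using disjoint_family_onD[OF J(5) that \<open>i \<in> J\<close>] by simp
        then have "s \<notin> B j" using \<open>s \<in> B i\<close> by blast
        then show ?thesis using False by simp
      qed (simp add: \<open>s \<in> B i\<close>)
      then have "(\<Sum>j\<in>J. \<theta> s * indicator (B j) s * k j) = (\<Sum>j\<in>J. if j = i then \<theta> s * k j else 0)"
        by (intro sum.cong) auto
      then show ?thesis using J(1) that(1) by simp
    qed
    have sum_b: "(\<Sum>j\<in>J. b j) = 0"
    proof -
      have "(\<Sum>j\<in>J. b j) = (\<integral>s. (\<Sum>j\<in>J. \<theta> s * indicator (B j) s) \<partial>m)"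
        unfolding b_def by (intro Bochner_Integration.integral_sum[symmetric] int_b)
      also have "(\<lambda>s. \<Sum>j\<in>J. \<theta> s * indicator (B j) s) = \<theta>"
      proof
        fix s
        show "(\<Sum>j\<in>J. \<theta> s * indicator (B j) s) = \<theta> s"
        proof (cases "s \<in> S")
          case True
          then obtain i where "i \<in> J" "s \<in> B i" using J(6) by blast
          from sum_ind[OF this, of "\<lambda>_. 1"] show ?thesis by simp
        qed (simp add: S(2))
      qed
      finally show ?thesis using th(2) by simp
    qed
    \<comment> \<open>Two errors add up: replacing \<open>\<theta> s\<close> by
      \<open>\<theta> z\<close>, which matters only where \<open>z \<cdot> iv s \<in> V\<close>, and
      replacing \<open>s\<close> by the sample point of its cell inside \<psi>.\<close>
    have diff: "\<bar>c * \<theta> z + -1 * G z\<bar> \<le> \<epsilon> * c * (1 + L1 \<theta>)" for z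
    proof -
      let ?F = "\<lambda>s. \<theta> z * \<psi> (z \<cdot> iv s) - (\<Sum>j\<in>J. \<theta> s * indicator (B j) s * \<psi> (z \<cdot> iv j))"
      have i1: "integrable m (\<lambda>s. \<theta> z * \<psi> (z \<cdot> iv s))"
        by (intro integrable_mult_right Cc_integrable Cc_psi)
      have i2: "integrable m (\<lambda>s. \<Sum>j\<in>J. \<theta> s * indicator (B j) s * \<psi> (z \<cdot> iv j))"
        by (intro Bochner_Integration.integrable_sum integrable_mult_left int_b)
      have "c * \<theta> z + -1 * G z = (\<integral>s. ?F s \<partial>m)"
      proof -
        have "(\<integral>s. (\<Sum>j\<in>J. \<theta> s * indicator (B j) s * \<psi> (z \<cdot> iv j)) \<partial>m) =
            (\<Sum>j\<in>J. \<integral>s. \<theta> s * indicator (B j) s * \<psi> (z \<cdot> iv j) \<partial>m)"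
          by (intro Bochner_Integration.integral_sum integrable_mult_left int_b)
        also have "\<dots> = G z" by (simp add: G_def b_def)
        finally show ?thesis
          using Bochner_Integration.integral_diff[OF i1 i2] by (simp add: int_psi)
      qed
      also have "\<bar>\<dots>\<bar> \<le> (\<integral>s. \<bar>?F s\<bar> \<partial>m)" by (rule integral_abs_bound)
      also have "\<dots> \<le> (\<integral>s. \<epsilon> * \<psi> (z \<cdot> iv s) + \<epsilon> * c * \<bar>\<theta> s\<bar> \<partial>m)"
      proof (rule integral_mono)
        show "integrable m (\<lambda>s. \<bar>?F s\<bar>)"
          by (intro integrable_abs Bochner_Integration.integrable_diff i1 i2)
        show "integrable m (\<lambda>s. \<epsilon> * \<psi> (z \<cdot> iv s) + \<epsilon> * c * \<bar>\<theta> s\<bar>)"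
          by (intro Bochner_Integration.integrable_add integrable_mult_right Cc_integrable Cc_psi Cc_abs th)
        fix s
        have near: "\<bar>\<theta> z - \<theta> s\<bar> * \<psi> (z \<cdot> iv s) \<le> \<epsilon> * \<psi> (z \<cdot> iv s)"
        proof (cases "z \<cdot> iv s \<in> V \<inter> interior C")
          case True
          then have "\<bar>\<theta> (z \<cdot> iv s \<cdot> s) - \<theta> s\<bar> < \<epsilon>" by (intro V(3)) simp
          then show ?thesis using psi(2) by (intro mult_right_mono) (auto simp: assoc)
        qed (simp add: psi(4))
        show "\<bar>?F s\<bar> \<le> \<epsilon> * \<psi> (z \<cdot> iv s) + \<epsilon> * c * \<bar>\<theta> s\<bar>"
        proof (cases "s \<in> S")
          case True
          then obtain i where i: "i \<in> J" "s \<in> B i" using J(6) by blast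
          then have "s \<cdot> iv i \<in> W" using J(4) mem_rtrans by blast
          then have "\<bar>\<psi> (z \<cdot> iv s \<cdot> (s \<cdot> iv i)) - \<psi> (z \<cdot> iv s)\<bar> < \<epsilon> * c" by (rule W(3))
          then have *: "\<bar>\<psi> (z \<cdot> iv i) - \<psi> (z \<cdot> iv s)\<bar> \<le> \<epsilon> * c" by (simp add: assoc)
          have "?F s = (\<theta> z - \<theta> s) * \<psi> (z \<cdot> iv s) - \<theta> s * (\<psi> (z \<cdot> iv i) - \<psi> (z \<cdot> iv s))"
            unfolding sum_ind[OF i] by (simp add: algebra_simps)
          also have "\<bar>\<dots>\<bar> \<le> \<bar>\<theta> z - \<theta> s\<bar> * \<psi> (z \<cdot> iv s) + \<bar>\<theta> s\<bar> * \<bar>\<psi> (z \<cdot> iv i) - \<psi> (z \<cdot> iv s)\<bar>"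
            using psi(2)[of "z \<cdot> iv s"] by (intro order_trans[OF abs_triangle_ineq4]) (simp add: abs_mult)
          also have "\<dots> \<le> \<epsilon> * \<psi> (z \<cdot> iv s) + \<bar>\<theta> s\<bar> * (\<epsilon> * c)"
            by (intro add_mono near mult_left_mono *) simp
          finally show ?thesis by (simp add: mult_ac)
        next
          case False
          then show ?thesis using near psi(2)[of "z \<cdot> iv s"] S(2)[OF False] by (simp add: abs_mult)
        qed
      qed
      also have "\<dots> = \<epsilon> * c + \<epsilon> * c * L1 \<theta>"
      proof -
        have j1: "integrable m (\<lambda>s. \<epsilon> * \<psi> (z \<cdot> iv s))" and j2: "integrable m (\<lambda>s. \<epsilon> * c * \<bar>\<theta> s\<bar>)"
          by (intro integrable_mult_right Cc_integrable Cc_psi Cc_abs th)+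
        show ?thesis unfolding Bochner_Integration.integral_add[OF j1 j2] by (simp add: int_psi L1_def)
      qed
      finally show ?thesis by (simp add: algebra_simps)
    qed
    have D_Cc: "(\<lambda>z. c * \<theta> z + -1 * G z) \<in> Cc" by (intro Cc_add Cc_scale th G_Cc)
    have "L1 (\<lambda>z. c * \<theta> z + -1 * G z) \<le> \<epsilon> * c * (1 + L1 \<theta>) * measure m (C \<star> S)"
    proof (rule L1_bound[OF D_Cc])
      show "compact (C \<star> S)" by (intro compact_setmul C S)
      show "\<bar>c * \<theta> z + -1 * G z\<bar> \<le> \<epsilon> * c * (1 + L1 \<theta>)" for z by (rule diff)
      fix z assume z: "z \<notin> C \<star> S"
      have eC: "e \<in> C" using C(2) interior_subset by blast
      have "z \<notin> S" using z setmulI[of e C z S] eC by auto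
      moreover have "\<psi> (z \<cdot> iv j) = 0" if "j \<in> J" for j
      proof -
        have "z \<cdot> iv j \<notin> C"
          using z setmulI[of "z \<cdot> iv j" C j S] that J(2) by (auto simp: assoc)
        then show ?thesis using psi(4) interior_subset by blast
      qed
      ultimately show "c * \<theta> z + -1 * G z = 0" by (simp add: S(2) G_def)
    qed
    then have "\<bar>I (\<lambda>z. c * \<theta> z + -1 * G z)\<bar> \<le> \<epsilon> * c * (1 + L1 \<theta>) * M"
      using bound[OF D_Cc] by (simp add: M_def)
    moreover have "I (\<lambda>z. c * \<theta> z + -1 * G z) = c * I \<theta>"
    proof -
      have Ia: "\<And>f g. f \<in> Cc \<Longrightarrow> g \<in> Cc \<Longrightarrow> I (\<lambda>x. f x + g x) = I f + I g"
        and Is: "\<And>f c. f \<in> Cc \<Longrightarrow> I (\<lambda>x. c * f x) = c * I f"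
        using lin unfolding linear_form_on_def by blast+
      have "I G = (\<Sum>j\<in>J. b j * I (\<lambda>z. \<psi> (z \<cdot> iv j)))"
        unfolding G_def by (intro linear_form_sum[OF Cc_subspace lin] Cc_rtrans psi)
      also have "\<dots> = (\<Sum>j\<in>J. b j) * I \<psi>" by (simp add: inv psi(1) sum_distrib_right)
      finally have "I G = 0" using sum_b by simp
      moreover have "I (\<lambda>z. c * \<theta> z + -1 * G z) = c * I \<theta> + -1 * I G"
        using Ia[OF Cc_scale[OF th(1)] Cc_scale[OF G_Cc], of c "-1"] Is[OF th(1), of c] Is[OF G_Cc, of "-1"]
        by argo
      ultimately show ?thesis by simp
    qed
    ultimately have "c * \<bar>I \<theta>\<bar> \<le> c * (M * (1 + L1 \<theta>) * \<epsilon>)" using c by (simp add: abs_mult mult_ac)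
    then show ?thesis using c by simp
  qed
  define Q where "Q = M * (1 + L1 \<theta>)"
  have Q: "Q \<ge> 0" using M L1_nonneg[of \<theta>] by (simp add: Q_def)
  have "\<bar>I \<theta>\<bar> \<le> 0 + d" if "d > 0" for d
  proof -
    have "d / (Q + 1) > 0" using Q that by simp
    from main[OF this] have "\<bar>I \<theta>\<bar> \<le> Q * (d / (Q + 1))" by (simp add: Q_def)
    also have "\<dots> \<le> d" using Q that by (simp add: field_simps)
    finally show ?thesis by simp
  qed
  then have "\<bar>I \<theta>\<bar> \<le> 0" by (rule field_le_epsilon)
  then show ?thesis by simp
qed

section \<open>Amenability\<close>

text \<open>Linearity and positivity give monotonicity, and normalization fixes the value at
  constants; the later use is to bound the mean between constants.\<close>

lemma amenable_mean:
  assumes "amenable_group mul m"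
  shows "\<exists>M :: ('a \<Rightarrow> real) \<Rightarrow> real.
    (\<forall>f\<in>Linf m. \<forall>g\<in>Linf m. M (\<lambda>x. f x + g x) = M f + M g) \<and>
    (\<forall>f\<in>Linf m. \<forall>c. M (\<lambda>x. c * f x) = c * M f) \<and>
    (\<forall>f\<in>Linf m. \<forall>g\<in>Linf m. (\<forall>x. f x \<le> g x) \<longrightarrow> M f \<le> M g) \<and>
    (\<forall>c. M (\<lambda>x. c) = c) \<and>
    (\<forall>f\<in>Linf m. \<forall>s. M (\<lambda>x. f (s \<cdot> x)) = M f)"
proof -
  obtain M :: "('a \<Rightarrow> real) \<Rightarrow> real" where
    M: "\<forall>f \<in> Linf m. \<forall>g \<in> Linf m. M (\<lambda>x. f x + g x) = M f + M g"
     "\<forall>f \<in> Linf m. \<forall>c. M (\<lambda>x. c * f x) = c * M f"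
     "\<forall>f \<in> Linf m. (AE x in m. 0 \<le> f x) \<longrightarrow> 0 \<le> M f"
     "M (\<lambda>x. 1) = 1"
     "\<forall>f \<in> Linf m. \<forall>s. M (\<lambda>x. f (s \<cdot> x)) = M f"
    using assms unfolding amenable_group_def by blast
  have scale: "(\<lambda>x. c * f x) \<in> Linf m" if f: "f \<in> Linf m" for f c
  proof -
    obtain C where "AE x in m. \<bar>f x\<bar> \<le> C" using f by (auto simp: Linf_def)
    then have "AE x in m. \<bar>c * f x\<bar> \<le> \<bar>c\<bar> * C"
      by (rule AE_mp) (auto simp: abs_mult mult_left_mono)
    then show ?thesis using f by (auto simp: Linf_def)
  qed
  have add: "(\<lambda>x. f x + g x) \<in> Linf m" if f: "f \<in> Linf m" and g: "g \<in> Linf m" for f g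
  proof -
    obtain C D where "AE x in m. \<bar>f x\<bar> \<le> C" "AE x in m. \<bar>g x\<bar> \<le> D" using f g by (auto simp: Linf_def)
    then have "AE x in m. \<bar>f x + g x\<bar> \<le> C + D" by eventually_elim linarith
    then show ?thesis using f g by (auto simp: Linf_def)
  qed
  have one: "(\<lambda>x. 1) \<in> Linf m" by (auto simp: Linf_def)
  have const: "M (\<lambda>x. c) = c" for c using M(2)[rule_format, OF one, of c] M(4) by simp
  have mono: "M f \<le> M g" if fg: "f \<in> Linf m" "g \<in> Linf m" "\<forall>x. f x \<le> g x" for f g
  proof -
    have "0 \<le> M (\<lambda>x. g x + -1 * f x)"
      using M(3) add[OF fg(2) scale[OF fg(1), of "-1"]] fg(3) by simp
    also have "\<dots> = M g + M (\<lambda>x. -1 * f x)"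
      by (rule M(1)[rule_format, OF fg(2) scale[OF fg(1), of "-1"]])
    also have "\<dots> = M g - M f" using M(2)[rule_format, OF fg(1), of "-1"] by simp
    finally show ?thesis by simp
  qed
  show ?thesis
    by (rule exI[of _ M]) (intro conjI M(1) M(2) M(5); use const mono in blast)
qed

text \<open>By Hahn-Banach, a lower bound on \<open>\<parallel>T \<theta>\<parallel>\<^sub>1\<close> over all right averages yields an
  \<open>L\<^sup>1\<close>-bounded functional that is bounded below on all right translates of \<open>\<theta>\<close>; averaging it
  with the invariant mean makes it right invariant, hence it vanishes at \<open>\<theta>\<close>.\<close>

lemma reiter:
  assumes am: "amenable_group mul m" and th: "\<theta> \<in> Cc" "(\<integral>x. \<theta> x \<partial>m) = 0" and eta: "\<eta> > 0"
  shows "\<exists>T. posop 1 T \<and> L1 (T \<theta>) < \<eta>"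
proof (rule ccontr)
  assume "\<not> ?thesis"
  then have no: "\<eta> \<le> L1 (T \<theta>)" if "posop 1 T" for T using that by force
  \<comment> \<open>Rescaling extends the bound from convex combinations to the cone of all positive
    ones. On the cone, adding and scaling operators makes the infimum \<open>p\<close>
    sublinear.\<close>
  have ge: "\<eta> * s \<le> L1 (T \<theta>)" if T: "posop s T" for s T
  proof (cases "s = 0")
    case True
    then show ?thesis by (simp add: L1_nonneg)
  next
    case False
    then have s: "s > 0" using posop_mass_nonneg[OF T] by simp
    have "posop (1 / s * s) (\<lambda>f x. 1 / s * T f x)" using s by (intro posop.scale T) simp
    then have "\<eta> \<le> L1 (\<lambda>x. 1 / s * T \<theta> x)" using s no by auto
    also have "\<dots> = L1 (T \<theta>) / s" using s by (subst L1_scale) simp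
    finally show ?thesis using s by (simp add: field_simps)
  qed
  \<comment> \<open>This functional encodes the separation: the zero operator gives
    \<open>p \<phi> \<le> L1 \<phi>\<close>, while at the negative of a right translate of \<theta>
    it is at most \<open>- \<eta>\<close>. The bound \<open>ge\<close> keeps the infimum
    finite.\<close>
  define S where "S \<phi> = {L1 (\<lambda>x. \<phi> x + T \<theta> x) - \<eta> * s | s T. posop s T}" for \<phi>
  define p where "p \<phi> = Inf (S \<phi>)" for \<phi>
  have zero_op: "posop 0 (\<lambda>f x. 0 * f (x \<cdot> iv e))" using posop.scale[of 0, OF _ posop.transl[of e]] by simp
  have lower: "- L1 \<phi> \<le> L1 (\<lambda>x. \<phi> x + T \<theta> x) - \<eta> * s" if phi: "\<phi> \<in> Cc" and T: "posop s T" for \<phi> s T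
  proof -
    have "L1 (T \<theta>) = L1 (\<lambda>x. (\<phi> x + T \<theta> x) + -1 * \<phi> x)" by simp
    also have "\<dots> \<le> L1 (\<lambda>x. \<phi> x + T \<theta> x) + L1 (\<lambda>x. -1 * \<phi> x)"
      by (intro L1_add Cc_add Cc_scale phi posop_Cc[OF T] th)
    also have "L1 (\<lambda>x. -1 * \<phi> x) = L1 \<phi>" by (subst L1_scale) simp
    finally show ?thesis using ge[OF T] by simp
  qed
  have p_le: "p \<phi> \<le> L1 (\<lambda>x. \<phi> x + T \<theta> x) - \<eta> * s" if "\<phi> \<in> Cc" "posop s T" for \<phi> s T
    unfolding p_def
  proof (rule cInf_lower)
    show "bdd_below (S \<phi>)" using lower[OF that(1)] by (intro bdd_belowI[of _ "- L1 \<phi>"]) (auto simp: S_def)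
  qed (use that in \<open>auto simp: S_def\<close>)
  have p_ge: "b \<le> p \<phi>" if "\<And>s T. posop s T \<Longrightarrow> b \<le> L1 (\<lambda>x. \<phi> x + T \<theta> x) - \<eta> * s" for b \<phi>
    unfolding p_def
  proof (rule cInf_greatest)
    show "S \<phi> \<noteq> {}" using zero_op unfolding S_def by blast
  qed (use that in \<open>auto simp: S_def\<close>)
  have sub_add: "p (\<lambda>x. f x + g x) \<le> p f + p g" if f: "f \<in> Cc" and g: "g \<in> Cc" for f g
  proof -
    have *: "p (\<lambda>x. f x + g x) \<le> (L1 (\<lambda>x. f x + T \<theta> x) - \<eta> * s) + (L1 (\<lambda>x. g x + R \<theta> x) - \<eta> * r)"
      if T: "posop s T" and R: "posop r R" for s T r R
    proof -
      have "p (\<lambda>x. f x + g x) \<le> L1 (\<lambda>x. f x + g x + (T \<theta> x + R \<theta> x)) - \<eta> * (s + r)"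
        by (rule p_le[OF Cc_add[OF f g] posop.add[OF T R]])
      also have "(\<lambda>x. f x + g x + (T \<theta> x + R \<theta> x)) = (\<lambda>x. (f x + T \<theta> x) + (g x + R \<theta> x))"
        by (simp add: algebra_simps)
      also have "L1 \<dots> \<le> L1 (\<lambda>x. f x + T \<theta> x) + L1 (\<lambda>x. g x + R \<theta> x)"
        by (intro L1_add Cc_add f g posop_Cc[OF T] posop_Cc[OF R] th)
      finally show ?thesis by (simp add: algebra_simps)
    qed
    have "p (\<lambda>x. f x + g x) - (L1 (\<lambda>x. g x + R \<theta> x) - \<eta> * r) \<le> p f" if "posop r R" for r R
      using *[OF _ that] by (intro p_ge) (simp add: algebra_simps)
    then have "p (\<lambda>x. f x + g x) - p f \<le> p g" by (intro p_ge) (simp add: algebra_simps)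
    then show ?thesis by simp
  qed
  have sub_scale: "p (\<lambda>x. c * f x) = c * p f" if f: "f \<in> Cc" and c: "c \<ge> 0" for f c
  proof (cases "c = 0")
    case True
    have "p (\<lambda>x. 0) \<le> 0" using p_le[OF Cc_zero zero_op] by (simp add: L1_def)
    moreover have "0 \<le> p (\<lambda>x. 0)" using ge by (intro p_ge) simp
    ultimately show ?thesis using True by simp
  next
    case False
    then have c: "c > 0" using c by simp
    have le: "p (\<lambda>x. c * f x) \<le> c * p f" if f: "f \<in> Cc" and c: "c > 0" for f c
    proof -
      have "p (\<lambda>x. c * f x) / c \<le> p f"
      proof (rule p_ge)
        fix s T assume T: "posop s T"
        have "posop (c * s) (\<lambda>f x. c * T f x)" using c by (intro posop.scale T) simp
        from p_le[OF Cc_scale[OF f, of c] this]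
        have "p (\<lambda>x. c * f x) \<le> L1 (\<lambda>x. c * f x + c * T \<theta> x) - \<eta> * (c * s)" .
        also have "(\<lambda>x. c * f x + c * T \<theta> x) = (\<lambda>x. c * (f x + T \<theta> x))" by (simp add: algebra_simps)
        also have "L1 \<dots> = c * L1 (\<lambda>x. f x + T \<theta> x)" using c by (subst L1_scale) simp
        finally have "p (\<lambda>x. c * f x) \<le> (L1 (\<lambda>x. f x + T \<theta> x) - \<eta> * s) * c"
          by (simp add: algebra_simps)
        then show "p (\<lambda>x. c * f x) / c \<le> L1 (\<lambda>x. f x + T \<theta> x) - \<eta> * s"
          using c by (simp add: pos_divide_le_eq)
      qed
      then show ?thesis using c by (simp add: divide_le_eq mult.commute)
    qed
    have "p (\<lambda>x. 1 / c * (c * f x)) \<le> 1 / c * p (\<lambda>x. c * f x)"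
      using c by (intro le Cc_scale f) simp
    also have "(\<lambda>x. 1 / c * (c * f x)) = f" using c by simp
    finally have "c * p f \<le> p (\<lambda>x. c * f x)" using c by (simp add: pos_le_divide_eq mult.commute)
    then show ?thesis using le[OF f c] by simp
  qed
  have "sublinear_on Cc p" using sub_add sub_scale by (simp add: sublinear_on_def)
  then obtain h where h: "linear_form_on Cc h" and hp: "\<And>f. f \<in> Cc \<Longrightarrow> h f \<le> p f"
    using hahn_banach[OF Cc_subspace] by metis
  have h_add: "h (\<lambda>x. f x + g x) = h f + h g" if "f \<in> Cc" "g \<in> Cc" for f g
    using h that unfolding linear_form_on_def by blast
  have h_scale: "h (\<lambda>x. c * f x) = c * h f" if "f \<in> Cc" for f c
    using h that unfolding linear_form_on_def by blast
  have h_L1: "\<bar>h f\<bar> \<le> L1 f" if f: "f \<in> Cc" for f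
  proof -
    have le: "h f \<le> L1 f" if "f \<in> Cc" for f
      using hp[OF that] p_le[OF that zero_op] by simp
    have "- h f \<le> L1 (\<lambda>x. -1 * f x)" using le[OF Cc_scale[OF f, of "-1"]] h_scale[OF f, of "-1"] by simp
    then have "- h f \<le> L1 f" by (subst (asm) L1_scale) simp
    then show ?thesis using le[OF f] by simp
  qed
  \<comment> \<open>Choose the translation by \<open>t\<close> itself in the infimum defining
    \<open>p\<close>: it cancels the argument, leaving \<open>- \<eta>\<close>.\<close>
  have h_th: "\<eta> \<le> h (\<lambda>x. \<theta> (x \<cdot> iv t))" for t
  proof -
    have mem: "(\<lambda>x. \<theta> (x \<cdot> iv t)) \<in> Cc" by (rule Cc_rtrans[OF th(1)])
    have "h (\<lambda>x. -1 * \<theta> (x \<cdot> iv t)) \<le> L1 (\<lambda>x. -1 * \<theta> (x \<cdot> iv t) + \<theta> (x \<cdot> iv t)) - \<eta> * 1"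
      by (rule order_trans[OF hp[OF Cc_scale[OF mem]] p_le[OF Cc_scale[OF mem] posop.transl]])
    then show ?thesis using h_scale[OF mem, of "-1"] by (simp add: L1_def)
  qed
  obtain M :: "('a \<Rightarrow> real) \<Rightarrow> real" where
    M: "\<forall>f\<in>Linf m. \<forall>g\<in>Linf m. M (\<lambda>x. f x + g x) = M f + M g"
      "\<forall>f\<in>Linf m. \<forall>c. M (\<lambda>x. c * f x) = c * M f"
      "\<forall>f\<in>Linf m. \<forall>g\<in>Linf m. (\<forall>x. f x \<le> g x) \<longrightarrow> M f \<le> M g"
      "\<forall>c. M (\<lambda>x. c) = c"
      "\<forall>f\<in>Linf m. \<forall>s. M (\<lambda>x. f (s \<cdot> x)) = M f"
    using amenable_mean[OF am] by blast
  note M_add = M(1)[rule_format] and M_scale = M(2)[rule_format] and M_mono = M(3)[rule_format]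
    and M_const = M(4)[rule_format] and M_inv = M(5)[rule_format]
  define H where "H f t = h (\<lambda>x. f (x \<cdot> iv t))" for f t
  have H_bound: "\<bar>H f t\<bar> \<le> L1 f" if f: "f \<in> Cc" for f t
    using h_L1[OF Cc_rtrans[OF f, of "iv t"]] L1_rtrans[OF f, of "iv t"] by (simp add: H_def)
  have const_Linf: "(\<lambda>x. c) \<in> Linf m" for c by (auto simp: Linf_def)
  have H_Linf: "H f \<in> Linf m" if f: "f \<in> Cc" for f
  proof -
    \<comment> \<open>Translating by \<open>iv t\<close> is translating by
      \<open>s \<cdot> iv t\<close> followed by \<open>iv s\<close>. The L1 norm is right invariant,
      so only \<open>s \<cdot> iv t\<close> near \<open>e\<close> matters.\<close>
    have "continuous_on UNIV (H f)"
      unfolding continuous_on_def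
    proof
      fix s
      show "(H f \<longlongrightarrow> H f s) (at s within UNIV)"
      proof (rule tendstoI)
        fix c :: real assume "c > 0"
        then obtain V where V: "open V" "e \<in> V" "\<And>v. v \<in> V \<Longrightarrow> L1 (\<lambda>x. f (x \<cdot> v) - f x) < c"
          using L1_rtrans_small[OF f] by metis
        let ?U = "(\<lambda>t. s \<cdot> iv t) -` V"
        have "open ?U" using V(1) by (intro open_vimage continuous_intros)
        moreover have "s \<in> ?U" using V(2) by simp
        moreover have "dist (H f t) (H f s) < c" if t: "t \<in> ?U" for t
        proof -
          let ?g = "\<lambda>x. f (x \<cdot> (s \<cdot> iv t)) - f x"
          have g: "?g \<in> Cc" by (intro Cc_diff Cc_rtrans f)
          have "H f t = h (\<lambda>x. f (x \<cdot> iv s) + ?g (x \<cdot> iv s))" by (simp add: H_def assoc)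
          also have "\<dots> = H f s + h (\<lambda>x. ?g (x \<cdot> iv s))"
            unfolding H_def by (rule h_add[OF Cc_rtrans[OF f] Cc_rtrans[OF g]])
          finally have "dist (H f t) (H f s) \<le> L1 (\<lambda>x. ?g (x \<cdot> iv s))"
            using h_L1[OF Cc_rtrans[OF g, of "iv s"]] by (simp add: dist_real_def)
          also have "\<dots> < c" unfolding L1_rtrans[OF g] using V(3) t by simp
          finally show ?thesis .
        qed
        ultimately show "\<forall>\<^sub>F t in at s within UNIV. dist (H f t) (H f s) < c"
          unfolding eventually_at_topological by blast
      qed
    qed
    then have "H f \<in> borel_measurable borel" by (rule borel_measurable_continuous_onI)
    then have "H f \<in> borel_measurable m" using measurable_cong_sets[OF sets_m refl] by blast
    then show ?thesis using H_bound[OF f] by (auto simp: Linf_def)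
  qed
  define I where "I f = M (H f)" for f
  have "I \<theta> = 0"
  proof (rule invariant_form_zero[of I \<theta>])
    have "I (\<lambda>x. f x + g x) = I f + I g" if f: "f \<in> Cc" and g: "g \<in> Cc" for f g
    proof -
      have "H (\<lambda>x. f x + g x) = (\<lambda>t. H f t + H g t)"
        unfolding H_def by (rule ext) (intro h_add Cc_rtrans f g)
      then show ?thesis unfolding I_def using M_add H_Linf f g by simp
    qed
    moreover have Is: "I (\<lambda>x. c * f x) = c * I f" if f: "f \<in> Cc" for f c
    proof -
      have "H (\<lambda>x. c * f x) = (\<lambda>t. c * H f t)"
        unfolding H_def by (rule ext) (intro h_scale Cc_rtrans f)
      then show ?thesis unfolding I_def using M_scale H_Linf f by simp
    qed
    ultimately show "linear_form_on Cc I" by (simp add: linear_form_on_def)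
    show "\<bar>I f\<bar> \<le> L1 f" if f: "f \<in> Cc" for f
    proof -
      have "H f t \<le> L1 f" "- L1 f \<le> H f t" for t using H_bound[OF f, of t] by auto
      then have "M (H f) \<le> M (\<lambda>t. L1 f)" "M (\<lambda>t. - L1 f) \<le> M (H f)"
        by (intro M_mono H_Linf f const_Linf; simp)+
      then show ?thesis by (simp add: I_def M_const)
    qed
    show "I (\<lambda>x. f (x \<cdot> iv s)) = I f" if f: "f \<in> Cc" for f s
    proof -
      \<comment> \<open>A right translation of \<open>f\<close> becomes a left translation of
        \<open>H f\<close>, since \<open>iv t \<cdot> iv s\<close> is the inverse of
        \<open>s \<cdot> t\<close>. This is where the left invariance of the mean enters.\<close>
      have "H (\<lambda>x. f (x \<cdot> iv s)) = (\<lambda>t. H f (s \<cdot> t))"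
        by (rule ext) (simp add: H_def inverse_distrib_swap assoc)
      then show ?thesis unfolding I_def using M_inv[OF H_Linf[OF f]] by simp
    qed
  qed (rule th)+
  moreover have "\<eta> \<le> I \<theta>"
  proof -
    have "M (\<lambda>t. \<eta>) \<le> M (H \<theta>)"
      by (rule M_mono[OF const_Linf H_Linf[OF th(1)]]) (simp add: H_def h_th)
    then show ?thesis by (simp add: I_def M_const)
  qed
  ultimately show False using eta by simp
qed

text \<open>Apply the one-function case to \<open>T (\<theta> i)\<close>, whose integral is again
  zero, and compose. An average of mass 1 does not increase L1 norms, so the functions already
  treated stay small.\<close>

lemma reiter_finite:
  assumes am: "amenable_group mul m" and fin: "finite J"
    and th: "\<And>i. i \<in> J \<Longrightarrow> \<theta> i \<in> Cc" "\<And>i. i \<in> J \<Longrightarrow> (\<integral>x. \<theta> i x \<partial>m) = 0" and eta: "\<eta> > 0"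
  shows "\<exists>T. posop 1 T \<and> (\<forall>i\<in>J. L1 (T (\<theta> i)) < \<eta>)"
  using fin th
proof (induction J rule: finite_induct)
  case empty
  show ?case using posop.transl by auto
next
  case (insert i J)
  have "\<exists>T. posop 1 T \<and> (\<forall>j\<in>J. L1 (T (\<theta> j)) < \<eta>)"
    by (rule insert.IH) (use insert.prems in auto)
  then obtain T where T: "posop 1 T" "\<forall>j\<in>J. L1 (T (\<theta> j)) < \<eta>" by blast
  have "T (\<theta> i) \<in> Cc" "(\<integral>x. T (\<theta> i) x \<partial>m) = 0"
    using posop_Cc[OF T(1)] posop_integral[OF T(1)] insert.prems by auto
  then obtain R where R: "posop 1 R" "L1 (R (T (\<theta> i))) < \<eta>" using reiter[OF am _ _ eta] by blast
  have "L1 (R (T (\<theta> j))) < \<eta>" if "j \<in> J" for j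
  proof -
    have "L1 (R (T (\<theta> j))) \<le> 1 * L1 (T (\<theta> j))"
      using that insert.prems by (intro posop_L1[OF R(1)] posop_Cc[OF T(1)]) simp
    then show ?thesis using T(2) that by force
  qed
  moreover have "posop 1 (\<lambda>f. R (T f))" using posop.comp[OF R(1) T(1)] by simp
  ultimately show ?case using R(2) by (intro exI[of _ "\<lambda>f. R (T f)"]) auto
qed

end

section \<open>Level sets and the Leptin condition\<close>

text \<open>This counts the integer levels reached by \<open>y\<close>, truncated at
  \<open>n\<close>; it is the pointwise identity behind the discretized layer-cake formula.\<close>

lemma sum_threshold:
  fixes y :: real assumes "y \<ge> 0"
  shows "(\<Sum>i=1..n. if real i \<le> y then 1 else 0 :: real) = real (min n (nat \<lfloor>y\<rfloor>))"
proof -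
  have "{i\<in>{1..n}. real i \<le> y} = {1..min n (nat \<lfloor>y\<rfloor>)}"
    using assms by (auto simp: le_nat_iff le_floor_iff)
  then have "(\<Sum>i=1..n. if real i \<le> y then 1 else 0 :: real) = real (card {1..min n (nat \<lfloor>y\<rfloor>)})"
    by (simp add: sum.If_cases Int_def)
  then show ?thesis by simp
qed

context unimodular_lc_group
begin

lemma compact_level_set:
  assumes "f \<in> Cc" "t > 0" shows "compact {x. t \<le> f x}"
proof -
  obtain S where S: "compact S" "\<And>x. x \<notin> S \<Longrightarrow> f x = 0" using Cc_supp[OF assms(1)] by blast
  have "closed {x. t \<le> f x}" by (intro closed_Collect_le continuous_intros Cc_cont assms)
  moreover have "{x. t \<le> f x} = S \<inter> {x. t \<le> f x}" using S(2) assms(2) by force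
  ultimately show ?thesis using compact_Int_closed[OF S(1)] by metis
qed

lemma m_fmeasurable: "compact A \<Longrightarrow> A \<in> fmeasurable m"
  using m_compact by (intro fmeasurableI) auto

lemma integrable_ind: "compact A \<Longrightarrow> integrable m (indicator A :: 'a \<Rightarrow> real)"
  using m_compact by (intro integrable_real_indicator) auto

text \<open>Layer-cake, in discretized form: if no level set of \<open>f\<close> satisfied the inequality, summing over
  the levels \<open>i/N\<close> would give \<open>r \<integral>f \<le> \<integral>g\<close> up to \<open>O(1/N)\<close>.\<close>

lemma level_set_exists:
  assumes f: "f \<in> Cc" "\<And>x. 0 \<le> f x" and g: "g \<in> Cc" "\<And>x. 0 \<le> g x"
    and K: "compact K" and fg: "\<And>k x. k \<in> K \<Longrightarrow> f (iv k \<cdot> x) \<le> g x"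
    and r: "r > 0" and less: "(\<integral>x. g x \<partial>m) < r * (\<integral>x. f x \<partial>m)"
  shows "\<exists>A. compact A \<and> emeasure m A > 0 \<and> measure m (K \<star> A) \<le> r * measure m A"
proof (rule ccontr)
  assume no: "\<not> ?thesis"
  obtain S where S: "compact S" "\<And>x. x \<notin> S \<Longrightarrow> f x = 0" using Cc_supp[OF f(1)] by blast
  have "continuous_on S f" using Cc_cont[OF f(1)] by (rule continuous_on_subset) simp
  then have "bounded (f ` S)" using S(1) by (intro compact_imp_bounded compact_continuous_image)
  then obtain B where B: "\<And>x. x \<in> S \<Longrightarrow> norm (f x) \<le> B" unfolding bounded_iff by blast
  define A where "A t = {x. t \<le> f x}" for t
  define D where "D t = {x. t \<le> g x}" for t
  have A: "compact (A t)" and D: "compact (D t)" if "t > 0" for t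
    unfolding A_def D_def using compact_level_set f(1) g(1) that by auto
  \<comment> \<open>The domination of the \<open>K\<close>-translates of \<open>f\<close> by
    \<open>g\<close> puts \<open>K \<star> A t\<close> inside \<open>D t\<close>. If
    \<open>A t\<close> is a null set, the inequality is trivial.\<close>
  have le: "r * measure m (A t) \<le> measure m (D t)" if t: "t > 0" for t
  proof -
    have "r * measure m (A t) \<le> measure m (K \<star> A t)"
    proof (cases "emeasure m (A t) > 0")
      case True
      then show ?thesis using no A[OF t] by force
    next
      case False
      then show ?thesis by (simp add: measure_def)
    qed
    also have "\<dots> \<le> measure m (D t)"
    proof (rule measure_mono_fmeasurable)
      show "K \<star> A t \<subseteq> D t"
      proof
        fix x assume "x \<in> K \<star> A t"
        then obtain k a where ka: "k \<in> K" "t \<le> f a" "x = k \<cdot> a" by (auto simp: setmul_def A_def)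
        then show "x \<in> D t" using fg[of k x] by (simp add: D_def)
      qed
      show "K \<star> A t \<in> sets m" using compact_setmul[OF K A[OF t]] by simp
    qed (rule m_fmeasurable[OF D[OF t]])
    finally show ?thesis .
  qed
  define d where "d = r * (\<integral>x. f x \<partial>m) - (\<integral>x. g x \<partial>m)"
  have "d > 0" using less by (simp add: d_def)
  \<comment> \<open>Rounding down to a level loses at most 1 at each point of \<open>S\<close>,
    hence at most \<open>r * measure m S\<close> after integrating and multiplying by
    \<open>r\<close>; the gap \<open>d\<close> is magnified by \<open>N\<close> to exceed
    this.\<close>
  then obtain N :: nat where N: "r * measure m S < real N * d" using ex_less_of_nat_mult by blast
  have N0: "N > 0"
  proof (rule ccontr)
    assume "\<not> N > 0"
    then have "r * measure m S < 0" using N by simp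
    then show False using r by (simp add: mult_less_0_iff)
  qed
  define t where "t i = real i / real N" for i :: nat
  have t_pos: "t i > 0" if "i \<in> {1..n}" for i n using that N0 by (simp add: t_def)
  \<comment> \<open>With this \<open>n\<close> the truncation loses nothing for \<open>f\<close>.
    For \<open>g\<close> truncation only lowers the sum, which is the harmless direction.\<close>
  obtain n :: nat where n: "real N * B \<le> real n" using real_arch_simple by blast
  have iff: "t i \<le> y \<longleftrightarrow> real i \<le> real N * y" for i y
    using N0 by (simp add: t_def divide_le_eq mult.commute)
  have "real N * (\<integral>x. f x \<partial>m) \<le> measure m S + (\<Sum>i=1..n. measure m (A (t i)))"
  proof -
    have iS: "integrable m (indicator S :: 'a \<Rightarrow> real)" by (rule integrable_ind[OF S(1)])
    have iA: "integrable m (indicator (A (t i)) :: 'a \<Rightarrow> real)" if "i \<in> {1..n}" for i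
      by (rule integrable_ind[OF A[OF t_pos[OF that]]])
    have iAs: "integrable m (\<lambda>x. \<Sum>i=1..n. indicator (A (t i)) x :: real)"
      by (rule Bochner_Integration.integrable_sum[OF iA])
    have "real N * (\<integral>x. f x \<partial>m) = (\<integral>x. real N * f x \<partial>m)" by simp
    also have "\<dots> \<le> (\<integral>x. indicator S x + (\<Sum>i=1..n. indicator (A (t i)) x) \<partial>m)"
    proof (rule integral_mono)
      show "integrable m (\<lambda>x. real N * f x)" by (intro integrable_mult_right Cc_integrable f)
      show "integrable m (\<lambda>x. indicator S x + (\<Sum>i=1..n. indicator (A (t i)) x) :: real)"
        by (rule Bochner_Integration.integrable_add[OF iS iAs])
      fix x
      show "real N * f x \<le> indicator S x + (\<Sum>i=1..n. indicator (A (t i)) x)"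
      proof (cases "x \<in> S")
        case True
        have "(\<Sum>i=1..n. indicator (A (t i)) x :: real) = (\<Sum>i=1..n. if real i \<le> real N * f x then 1 else 0)"
          by (intro sum.cong) (auto simp: A_def iff)
        also have "\<dots> = real (min n (nat \<lfloor>real N * f x\<rfloor>))" using f(2) by (intro sum_threshold) simp
        also have "\<dots> = real (nat \<lfloor>real N * f x\<rfloor>)"
        proof -
          have "real N * f x \<le> real N * B" using B[OF True] by (intro mult_left_mono) auto
          then have "real N * f x \<le> real n" using n by simp
          then have "nat \<lfloor>real N * f x\<rfloor> \<le> n" by linarith
          then show ?thesis by simp
        qed
        also have "\<dots> \<ge> real N * f x - 1" using f(2)[of x] by linarith
        finally show ?thesis using True by simp
      next
        case False
        then show ?thesis by (simp add: S(2) sum_nonneg)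
      qed
    qed
    also have "\<dots> = measure m S + (\<Sum>i=1..n. measure m (A (t i)))"
      by (subst Bochner_Integration.integral_add[OF iS iAs], subst Bochner_Integration.integral_sum[OF iA]) simp_all
    finally show ?thesis .
  qed
  then have "r * (real N * (\<integral>x. f x \<partial>m)) \<le> r * (measure m S + (\<Sum>i=1..n. measure m (A (t i))))"
    using r by (intro mult_left_mono) auto
  also have "\<dots> = r * measure m S + (\<Sum>i=1..n. r * measure m (A (t i)))"
    by (simp add: distrib_left sum_distrib_left)
  also have "(\<Sum>i=1..n. r * measure m (A (t i))) \<le> (\<Sum>i=1..n. measure m (D (t i)))"
    using t_pos by (intro sum_mono le)
  also have "\<dots> \<le> real N * (\<integral>x. g x \<partial>m)"
  proof -
    have iD: "integrable m (indicator (D (t i)) :: 'a \<Rightarrow> real)" if "i \<in> {1..n}" for i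
      by (rule integrable_ind[OF D[OF t_pos[OF that]]])
    have "(\<Sum>i=1..n. measure m (D (t i))) = (\<integral>x. (\<Sum>i=1..n. indicator (D (t i)) x) \<partial>m)"
      by (subst Bochner_Integration.integral_sum[OF iD]) simp_all
    also have "\<dots> \<le> (\<integral>x. real N * g x \<partial>m)"
    proof (rule integral_mono)
      show "integrable m (\<lambda>x. \<Sum>i=1..n. indicator (D (t i)) x :: real)"
        by (rule Bochner_Integration.integrable_sum[OF iD])
      show "integrable m (\<lambda>x. real N * g x)" by (intro integrable_mult_right Cc_integrable g)
      fix x
      have "(\<Sum>i=1..n. indicator (D (t i)) x :: real) = (\<Sum>i=1..n. if real i \<le> real N * g x then 1 else 0)"
        by (intro sum.cong) (auto simp: D_def iff)
      also have "\<dots> = real (min n (nat \<lfloor>real N * g x\<rfloor>))" using g(2) by (intro sum_threshold) simp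
      also have "\<dots> \<le> real (nat \<lfloor>real N * g x\<rfloor>)" by simp
      also have "\<dots> \<le> real N * g x" using g(2)[of x] by (intro of_nat_floor) simp
      finally show "(\<Sum>i=1..n. indicator (D (t i)) x) \<le> real N * g x" .
    qed
    finally show ?thesis by simp
  qed
  finally have "r * (real N * (\<integral>x. f x \<partial>m)) \<le> r * measure m S + real N * (\<integral>x. g x \<partial>m)" by simp
  then have "real N * d \<le> r * measure m S" by (simp add: d_def algebra_simps)
  then show False using N by simp
qed

text \<open>The average \<open>T \<phi>\<close> has a level set as required once some
  \<open>g\<close> dominates all its translates by \<open>K\<close> and has almost the same
  integral. Bounding by a sum over the finite set \<open>J\<close>, instead of a supremum over
  \<open>K\<close>, keeps \<open>g\<close> in \<open>Cc\<close>.\<close>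

lemma leptin_condition:
  assumes am: "amenable_group mul m" and K: "compact K" and eps: "\<epsilon> > 0"
  shows "\<exists>A. compact A \<and> emeasure m A > 0 \<and> measure m (K \<star> A) \<le> (1 + \<epsilon>) * measure m A"
proof -
  obtain \<phi> where phi: "\<phi> \<in> Cc" "\<And>x. 0 \<le> \<phi> x" "\<phi> e = 1"
    by (rule urysohn[of "{e}" UNIV]) auto
  define c where "c = (\<integral>x. \<phi> x \<partial>m)"
  have c: "c > 0" unfolding c_def by (rule integral_pos[OF phi(1,2), of e]) (simp add: phi)
  obtain S where S: "compact S" "\<And>x. x \<notin> S \<Longrightarrow> \<phi> x = 0" using Cc_supp[OF phi(1)] by blast
  obtain \<xi> where chi: "\<xi> \<in> Cc" "\<And>x. 0 \<le> \<xi> x" "\<And>x. x \<in> K \<star> S \<Longrightarrow> \<xi> x = 1"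
    by (rule urysohn[OF compact_setmul[OF K S(1)] open_UNIV]) auto
  define X where "X = (\<integral>x. \<xi> x \<partial>m)"
  have X: "X \<ge> 0" unfolding X_def using chi(2) by simp
  \<comment> \<open>The excess \<open>\<epsilon> * c\<close> is halved: \<delta> spends one half on
    the uniform error carried by \<xi>, and \<eta> spends the other on the \<open>card J\<close>
    differences. Since \<open>J\<close> depends on \<delta>, \<eta> comes second. The added 1 keeps
    the denominators positive.\<close>
  define \<delta> where "\<delta> = \<epsilon> * c / (2 * (X + 1))"
  have delta: "\<delta> > 0" using eps c X by (simp add: \<delta>_def)
  obtain V where V: "open V" "e \<in> V" "\<And>v x. v \<in> V \<Longrightarrow> \<bar>\<phi> (v \<cdot> x) - \<phi> x\<bar> < \<delta>"
    using unif_cont[OF phi(1) delta] by metis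
  have "K \<subseteq> (\<Union>k\<in>K. {k} \<star> iv ` V)" using V(2) by (auto simp: mem_ltrans mem_iv_image)
  then obtain J where J: "J \<subseteq> K" "finite J" "K \<subseteq> (\<Union>k\<in>J. {k} \<star> iv ` V)"
    using compactE_image[OF K, of K "\<lambda>k. {k} \<star> iv ` V"] open_ltrans[OF open_iv[OF V(1)]] by metis
  define \<eta> where "\<eta> = \<epsilon> * c / (2 * (real (card J) + 1))"
  have eta: "\<eta> > 0" using eps c by (simp add: \<eta>_def add_nonneg_pos)
  define \<theta> where "\<theta> i = (\<lambda>x. \<phi> (iv i \<cdot> x) - \<phi> x)" for i
  have th: "\<theta> i \<in> Cc" for i unfolding \<theta>_def by (intro Cc_diff Cc_ltrans phi)
  have th0: "(\<integral>x. \<theta> i x \<partial>m) = 0" for i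
    unfolding \<theta>_def
    using Bochner_Integration.integral_diff[OF Cc_integrable[OF Cc_ltrans[OF phi(1)]] Cc_integrable[OF phi(1)], of "iv i"]
    by (simp add: integral_ltrans phi(1))
  obtain T where T: "posop 1 T" "\<And>i. i \<in> J \<Longrightarrow> L1 (T (\<theta> i)) < \<eta>"
    using reiter_finite[OF am J(2), of \<theta>, OF th th0 eta] by blast
  have T_nonneg: "0 \<le> T f x" if "\<And>x. 0 \<le> f x" for f x
  proof -
    have "T (\<lambda>x. 0 * f x) x \<le> T f x" using that by (intro posop_mono[OF T(1)]) simp
    then show ?thesis using posop_scale[OF T(1), of 0 f] by simp
  qed
  define g where "g = (\<lambda>x. T \<phi> x + (\<Sum>i\<in>J. \<bar>T (\<theta> i) x\<bar>) + \<delta> * T \<xi> x)"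
  show ?thesis
  proof (rule level_set_exists)
    show "T \<phi> \<in> Cc" by (intro posop_Cc[OF T(1)] phi)
    show "0 \<le> T \<phi> x" for x by (rule T_nonneg[OF phi(2)])
    show "g \<in> Cc" unfolding g_def
      by (intro Cc_add Cc_sum Cc_abs Cc_scale posop_Cc[OF T(1)] phi chi th)
    show "0 \<le> g x" for x unfolding g_def
      using delta by (intro add_nonneg_nonneg sum_nonneg mult_nonneg_nonneg T_nonneg phi chi) auto
    show "T \<phi> (iv k \<cdot> x) \<le> g x" if k: "k \<in> K" for k x
    proof -
      obtain i where i: "i \<in> J" "iv k \<cdot> i \<in> V"
        using J(3) k by (auto simp: mem_ltrans mem_iv_image inverse_distrib_swap)
      \<comment> \<open>Here \<open>\<phi> y + \<theta> i y\<close> is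
        \<open>\<phi> (iv i \<cdot> y)\<close>. On \<open>K \<star> S\<close> uniform continuity
        costs at most \<delta>, where \<xi> equals 1; elsewhere the left side is zero. Positivity of
        \<open>T\<close> carries this pointwise bound over to the averages.\<close>
      have "\<phi> (iv k \<cdot> y) \<le> (\<phi> y + \<theta> i y) + \<delta> * \<xi> y" for y
      proof (cases "y \<in> K \<star> S")
        case True
        have "\<bar>\<phi> (iv k \<cdot> i \<cdot> (iv i \<cdot> y)) - \<phi> (iv i \<cdot> y)\<bar> < \<delta>" by (rule V(3)[OF i(2)])
        then show ?thesis using chi(3)[OF True] by (simp add: \<theta>_def assoc)
      next
        case False
        have "iv k \<cdot> y \<notin> S" using False setmulI[of k K "iv k \<cdot> y" S] k by auto
        then show ?thesis using S(2) phi(2)[of "iv i \<cdot> y"] chi(2)[of y] delta by (simp add: \<theta>_def)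
      qed
      then have "T (\<lambda>y. \<phi> (iv k \<cdot> y)) x \<le> T (\<lambda>y. (\<phi> y + \<theta> i y) + \<delta> * \<xi> y) x"
        by (rule posop_mono[OF T(1)])
      also have "T (\<lambda>y. (\<phi> y + \<theta> i y) + \<delta> * \<xi> y) x = T \<phi> x + T (\<theta> i) x + \<delta> * T \<xi> x"
        by (simp only: posop_add[OF T(1)] posop_scale[OF T(1)])
      also have "T (\<theta> i) x \<le> \<bar>T (\<theta> i) x\<bar>" by simp
      also have "\<dots> \<le> (\<Sum>i\<in>J. \<bar>T (\<theta> i) x\<bar>)"
        using i(1) J(2) by (intro member_le_sum) auto
      finally show ?thesis unfolding g_def posop_ltrans[OF T(1)] by simp
    qed
    show "(\<integral>x. g x \<partial>m) < (1 + \<epsilon>) * (\<integral>x. T \<phi> x \<partial>m)"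
    proof -
      have i1: "integrable m (T \<phi>)" and i2: "integrable m (\<lambda>x. \<bar>T (\<theta> i) x\<bar>)" and i3: "integrable m (T \<xi>)" for i
        by (intro Cc_integrable Cc_abs posop_Cc[OF T(1)] phi th chi)+
      have "(\<integral>x. g x \<partial>m) = c + (\<Sum>i\<in>J. L1 (T (\<theta> i))) + \<delta> * X"
        unfolding g_def c_def X_def L1_def
        by (simp add: i1 i2 i3 posop_integral[OF T(1)] phi(1) chi(1) Bochner_Integration.integral_sum)
      also have "(\<Sum>i\<in>J. L1 (T (\<theta> i))) \<le> (\<Sum>i\<in>J. \<eta>)"
        by (intro sum_mono less_imp_le T(2))
      also have "\<dots> \<le> \<epsilon> * c / 2" using eps c by (simp add: \<eta>_def field_simps)
      also have "\<delta> * X < \<epsilon> * c / 2" using eps c X by (simp add: \<delta>_def field_simps)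
      finally have "(\<integral>x. g x \<partial>m) < (1 + \<epsilon>) * c" by (simp add: algebra_simps)
      then show ?thesis using posop_integral[OF T(1) phi(1)] by (simp add: c_def)
    qed
  qed (use K eps in auto)
qed

end

section \<open>Densities\<close>

lemma ennreal_divide_mult_cancel:
  fixes a c :: ennreal
  assumes "c \<noteq> 0" "c \<noteq> top" shows "a / c * c = a"
  using assms by (simp add: ennreal_divide_times top.not_eq_extremum)

lemma ennreal_le_divide_iff:
  fixes a c x :: ennreal
  assumes "c \<noteq> 0" "c \<noteq> top" shows "x \<le> a / c \<longleftrightarrow> x * c \<le> a"
  using mult_right_mono[of x "a / c" c] divide_right_mono_ennreal[of "x * c" a c]
  by (auto simp: ennreal_divide_mult_cancel mult_divide_eq_ennreal assms)

lemma ennreal_divide_le_iff: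
  fixes a c x :: ennreal
  assumes "c \<noteq> 0" "c \<noteq> top" shows "a / c \<le> x \<longleftrightarrow> a \<le> x * c"
  using mult_right_mono[of "a / c" x c] divide_right_mono_ennreal[of a "x * c" c]
  by (auto simp: ennreal_divide_mult_cancel mult_divide_eq_ennreal assms)

context unimodular_lc_group
begin

lemma cpt_posD:
  assumes "A \<in> cpt_pos_sets m"
  shows "compact A" "A \<noteq> {}" "emeasure m A > 0" "emeasure m A \<noteq> 0" "emeasure m A \<noteq> top"
  using assms m_compact[of A] by (auto simp: cpt_pos_sets_def cpt_sets_def)

lemma cpt_posI: "compact A \<Longrightarrow> emeasure m A > 0 \<Longrightarrow> A \<in> cpt_pos_sets m"
  by (auto simp: cpt_pos_sets_def cpt_sets_def)

lemma cpt_pos_nonempty: "cpt_pos_sets m \<noteq> {}"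
proof -
  obtain C where "compact C" "e \<in> interior C" using compact_nhd[OF open_UNIV UNIV_I] by metis
  then have "C \<in> cpt_pos_sets m" by (intro cpt_posI m_interior_pos) auto
  then show ?thesis by blast
qed

lemma m_le_setmul:
  assumes "K \<in> cpt_sets" "compact A" shows "emeasure m A \<le> emeasure m (K \<star> A)"
proof -
  obtain k where k: "k \<in> K" using assms(1) by (auto simp: cpt_sets_def)
  have "emeasure m A = emeasure m ({k} \<star> A)" using assms(2) by (simp add: m_ltrans)
  also have "\<dots> \<le> emeasure m (K \<star> A)"
    using assms k by (intro emeasure_mono setmul_mono) (auto simp: cpt_sets_def compact_setmul)
  finally show ?thesis .
qed

lemma cpt_pos_setmul: "K \<in> cpt_sets \<Longrightarrow> A \<in> cpt_pos_sets m \<Longrightarrow> K \<star> A \<in> cpt_pos_sets m"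
  using m_le_setmul[of K A] cpt_posD[of A]
  by (intro cpt_posI compact_setmul) (auto simp: cpt_sets_def)

lemma cpt_pos_rtrans: "A \<in> cpt_pos_sets m \<Longrightarrow> A \<star> {s} \<in> cpt_pos_sets m"
  using cpt_posD[of A] by (intro cpt_posI compact_setmul) (auto simp: m_rtrans)

lemma one_le_leptin_invariant: "1 \<le> leptin_invariant mul m"
  unfolding leptin_invariant_def
proof (rule SUP_upper2)
  show "{e} \<in> cpt_sets" by (simp add: cpt_sets_def)
  then show "1 \<le> (INF A \<in> cpt_pos_sets m. emeasure m ({e} \<star> A) / emeasure m A)"
    using m_le_setmul cpt_posD by (intro INF_greatest) (simp add: ennreal_le_divide_iff)
qed

text \<open>For positive finite \<open>b\<close>, the quotient \<open>l / b\<close> is a lower bound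
  for the ratios whose infimum enters I(G) at \<open>K\<close>. The extreme values of
  \<open>b\<close> are separate: \<open>b = 0\<close> forces \<open>l = 0\<close>, and
  \<open>b = top\<close> gives a trivial bound because I(G) is nonzero.\<close>

lemma le_times_leptin_invariant:
  assumes K: "K \<in> cpt_sets"
    and le: "\<And>A. A \<in> cpt_pos_sets m \<Longrightarrow> l * emeasure m A \<le> b * emeasure m (K \<star> A)"
  shows "l \<le> b * leptin_invariant mul m"
proof -
  consider "b = 0" | "b = top" | "b \<noteq> 0" "b \<noteq> top" by blast
  then show ?thesis
  proof cases
    case 1
    obtain A where "A \<in> cpt_pos_sets m" using cpt_pos_nonempty by blast
    then have "l = 0" using le[of A] cpt_posD[of A] 1 by simp
    then show ?thesis by simp
  next
    case 2
    have "leptin_invariant mul m \<noteq> 0" using one_le_leptin_invariant by (metis le_zero_eq zero_neq_one)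
    then show ?thesis using 2 by (simp add: ennreal_top_mult)
  next
    case 3
    have "l / b \<le> (INF A \<in> cpt_pos_sets m. emeasure m (K \<star> A) / emeasure m A)"
    proof (rule INF_greatest)
      fix A assume A: "A \<in> cpt_pos_sets m"
      have "l * emeasure m A / b \<le> emeasure m (K \<star> A)"
        unfolding ennreal_divide_le_iff[OF 3] using le[OF A] by (simp add: mult.commute)
      then have "l / b * emeasure m A \<le> emeasure m (K \<star> A)"
        by (simp add: divide_ennreal_def mult_ac)
      then show "l / b \<le> emeasure m (K \<star> A) / emeasure m A"
        using cpt_posD[OF A] by (simp add: ennreal_le_divide_iff)
    qed
    also have "\<dots> \<le> leptin_invariant mul m"
      unfolding leptin_invariant_def using K by (rule SUP_upper)
    finally show ?thesis unfolding ennreal_divide_le_iff[OF 3] by (simp add: mult.commute)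
  qed
qed

lemma leptin_invariant_amenable:
  assumes "amenable_group mul m" shows "leptin_invariant mul m = 1"
proof (rule antisym[OF _ one_le_leptin_invariant])
  show "leptin_invariant mul m \<le> 1"
    unfolding leptin_invariant_def
  proof (rule SUP_least)
    fix K :: "'a set" assume "K \<in> cpt_sets"
    then have K: "compact K" by (simp add: cpt_sets_def)
    have "(INF A \<in> cpt_pos_sets m. emeasure m (K \<star> A) / emeasure m A) \<le> 1 + ennreal \<epsilon>" if eps: "\<epsilon> > 0" for \<epsilon>
    proof -
      obtain A where A: "compact A" "emeasure m A > 0" "measure m (K \<star> A) \<le> (1 + \<epsilon>) * measure m A"
        using leptin_condition[OF assms K eps] by blast
      have A': "A \<in> cpt_pos_sets m" by (rule cpt_posI[OF A(1,2)])
      have "emeasure m (K \<star> A) = ennreal (measure m (K \<star> A))"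
        using m_compact[OF compact_setmul[OF K A(1)]] by (intro emeasure_eq_ennreal_measure) simp
      also have "\<dots> \<le> ennreal ((1 + \<epsilon>) * measure m A)" by (rule ennreal_leI[OF A(3)])
      also have "\<dots> = (1 + ennreal \<epsilon>) * emeasure m A"
        using eps cpt_posD(5)[OF A'] by (simp add: ennreal_mult emeasure_eq_ennreal_measure)
      finally have "emeasure m (K \<star> A) / emeasure m A \<le> 1 + ennreal \<epsilon>"
        using cpt_posD[OF A'] by (simp add: ennreal_divide_le_iff)
      then show ?thesis using A' by (rule INF_lower2[rotated])
    qed
    then show "(INF A \<in> cpt_pos_sets m. emeasure m (K \<star> A) / emeasure m A) \<le> 1"
      by (blast intro: ennreal_le_epsilon)
  qed
qed

context
  fixes \<nu> :: "'a measure" assumes nu: "locally_finite_measure \<nu>"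
begin

section \<open>The inequalities between the densities\<close>

text \<open>The set \<open>A\<close> that tests the Beurling density is itself the competitor
  \<open>K\<close> in the Leptin density.\<close>

lemma lower_beurling_le_lower_leptin:
  "lower_beurling_density mul m \<nu> \<le> lower_leptin_density mul m \<nu>"
  unfolding lower_beurling_density_def rtrans_image
proof (rule SUP_least)
  fix A assume A: "A \<in> cpt_pos_sets m"
  let ?\<kappa> = "INF s. emeasure \<nu> (A \<star> {s}) / emeasure m A"
  have \<kappa>: "?\<kappa> * emeasure m A \<le> emeasure \<nu> (A \<star> {s})" for s
  proof -
    have "?\<kappa> \<le> emeasure \<nu> (A \<star> {s}) / emeasure m A" by (rule INF_lower) simp
    then show ?thesis using cpt_posD[OF A] by (simp add: ennreal_le_divide_iff)
  qed
  have "?\<kappa> \<le> (INF F \<in> cpt_pos_sets m. emeasure \<nu> (A \<star> F) / emeasure m F)"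
  proof (rule INF_greatest)
    fix F assume F: "F \<in> cpt_pos_sets m"
    show "?\<kappa> \<le> emeasure \<nu> (A \<star> F) / emeasure m F"
      unfolding ennreal_le_divide_iff[OF cpt_posD(4,5)[OF F]]
      by (rule beurling_le_leptin_lower[OF cpt_posD(1)[OF F] cpt_posD(1,3)[OF A] nu \<kappa>])
  qed
  also have "\<dots> \<le> lower_leptin_density mul m \<nu>"
    unfolding lower_leptin_density_def using A by (intro SUP_upper) (simp add: cpt_pos_sets_def)
  finally show "?\<kappa> \<le> lower_leptin_density mul m \<nu>" .
qed

lemma upper_leptin_le_upper_beurling:
  "upper_leptin_density mul m \<nu> \<le> upper_beurling_density mul m \<nu>"
  unfolding upper_beurling_density_def rtrans_image
proof (rule INF_greatest)
  fix A assume A: "A \<in> cpt_pos_sets m"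
  let ?\<kappa> = "SUP s. emeasure \<nu> (A \<star> {s}) / emeasure m A"
  have \<kappa>: "emeasure \<nu> (A \<star> {s}) \<le> ?\<kappa> * emeasure m A" for s
  proof -
    have "emeasure \<nu> (A \<star> {s}) / emeasure m A \<le> ?\<kappa>" by (rule SUP_upper) simp
    then show ?thesis using cpt_posD[OF A] by (simp add: ennreal_divide_le_iff)
  qed
  obtain K where K: "compact K" "K \<noteq> {}"
    and KF: "\<And>F. compact F \<Longrightarrow> emeasure m A * emeasure \<nu> F \<le> emeasure m (K \<star> F) * (?\<kappa> * emeasure m A)"
    using leptin_le_beurling_upper[OF cpt_posD(1,3)[OF A] nu \<kappa>] by metis
  have Kc: "K \<in> cpt_sets" using K by (simp add: cpt_sets_def)
  have "upper_leptin_density mul m \<nu> \<le> (SUP F \<in> cpt_pos_sets m. emeasure \<nu> F / emeasure m (K \<star> F))"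
    unfolding upper_leptin_density_def using Kc by (rule INF_lower)
  also have "\<dots> \<le> ?\<kappa>"
  proof (rule SUP_least)
    fix F assume F: "F \<in> cpt_pos_sets m"
    have "emeasure m A * emeasure \<nu> F \<le> emeasure m A * (?\<kappa> * emeasure m (K \<star> F))"
      using KF[OF cpt_posD(1)[OF F]] by (simp only: mult_ac)
    then have "emeasure \<nu> F \<le> ?\<kappa> * emeasure m (K \<star> F)"
      using ennreal_mult_le_mult_iff[OF cpt_posD(4,5)[OF A]] by blast
    then show "emeasure \<nu> F / emeasure m (K \<star> F) \<le> ?\<kappa>"
      unfolding ennreal_divide_le_iff[OF cpt_posD(4,5)[OF cpt_pos_setmul[OF Kc F]]] .
  qed
  finally show "upper_leptin_density mul m \<nu> \<le> ?\<kappa>" .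
qed

text \<open>The Leptin infimum at \<open>K\<close> also ranges over all translates
  \<open>A \<star> {s}\<close>, and multiplying these by \<open>K\<close> gives the translates of
  \<open>K \<star> A\<close>. So \<open>K \<star> A\<close> is a Beurling test set of density at
  least \<open>?l\<close> times \<open>emeasure m A / emeasure m (K \<star> A)\<close>.\<close>

lemma lower_leptin_le:
  "lower_leptin_density mul m \<nu> \<le> lower_beurling_density mul m \<nu> * leptin_invariant mul m"
  unfolding lower_leptin_density_def
proof (rule SUP_least)
  fix K :: "'a set" assume K: "K \<in> cpt_sets"
  let ?l = "INF A \<in> cpt_pos_sets m. emeasure \<nu> (K \<star> A) / emeasure m A"
  let ?b = "lower_beurling_density mul m \<nu>"
  show "?l \<le> ?b * leptin_invariant mul m"
  proof (rule le_times_leptin_invariant[OF K])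
    fix A assume A: "A \<in> cpt_pos_sets m"
    note KA = cpt_pos_setmul[OF K A]
    have "?l * emeasure m A \<le> emeasure \<nu> (K \<star> A \<star> {s})" for s
    proof -
      have "?l \<le> emeasure \<nu> (K \<star> (A \<star> {s})) / emeasure m (A \<star> {s})"
        by (rule INF_lower[OF cpt_pos_rtrans[OF A]])
      then show ?thesis
        using cpt_posD[OF A] by (simp add: m_rtrans setmul_assoc ennreal_le_divide_iff)
    qed
    then have "?l * emeasure m A / emeasure m (K \<star> A) \<le> (INF s. emeasure \<nu> (K \<star> A \<star> {s}) / emeasure m (K \<star> A))"
      by (intro INF_greatest divide_right_mono_ennreal)
    also have "\<dots> \<le> ?b"
      unfolding lower_beurling_density_def rtrans_image by (rule SUP_upper[OF KA])
    finally show "?l * emeasure m A \<le> ?b * emeasure m (K \<star> A)"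
      unfolding ennreal_divide_le_iff[OF cpt_posD(4,5)[OF KA]] .
  qed
qed

lemma le_upper_leptin:
  assumes K: "K \<in> cpt_sets" and A: "A \<in> cpt_pos_sets m"
  shows "emeasure \<nu> A \<le> (SUP A \<in> cpt_pos_sets m. emeasure \<nu> A / emeasure m (K \<star> A)) * emeasure m (K \<star> A)"
  unfolding ennreal_divide_le_iff[OF cpt_posD(4,5)[OF cpt_pos_setmul[OF K A]], symmetric]
  by (rule SUP_upper[OF A])

text \<open>The Leptin supremum at \<open>K\<close> bounds \<nu> on every
  \<open>A \<star> {s}\<close> by \<open>?u * emeasure m (K \<star> A)\<close>, a bound that is
  uniform in \<open>s\<close> by right invariance; hence \<open>A\<close> is a good Beurling test
  set.\<close>

lemma upper_beurling_le:
  "inverse (leptin_invariant mul m) * upper_beurling_density mul m \<nu> \<le> upper_leptin_density mul m \<nu>"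
  unfolding upper_leptin_density_def
proof (rule INF_greatest)
  fix K :: "'a set" assume K: "K \<in> cpt_sets"
  let ?u = "SUP A \<in> cpt_pos_sets m. emeasure \<nu> A / emeasure m (K \<star> A)"
  let ?I = "leptin_invariant mul m" and ?b = "upper_beurling_density mul m \<nu>"
  have "?b \<le> ?u * ?I"
  proof (rule le_times_leptin_invariant[OF K])
    fix A assume A: "A \<in> cpt_pos_sets m"
    have "?b \<le> (SUP s. emeasure \<nu> (A \<star> {s}) / emeasure m A)"
      unfolding upper_beurling_density_def rtrans_image by (rule INF_lower[OF A])
    also have "\<dots> \<le> ?u * emeasure m (K \<star> A) / emeasure m A"
    proof (intro SUP_least divide_right_mono_ennreal)
      fix s
      have "emeasure \<nu> (A \<star> {s}) \<le> ?u * emeasure m (K \<star> (A \<star> {s}))"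
        by (rule le_upper_leptin[OF K cpt_pos_rtrans[OF A]])
      also have "emeasure m (K \<star> (A \<star> {s})) = emeasure m (K \<star> A)"
        using cpt_posD(1)[OF cpt_pos_setmul[OF K A]] by (simp add: m_rtrans flip: setmul_assoc)
      finally show "emeasure \<nu> (A \<star> {s}) \<le> ?u * emeasure m (K \<star> A)" .
    qed
    finally show "?b * emeasure m A \<le> ?u * emeasure m (K \<star> A)"
      unfolding ennreal_le_divide_iff[OF cpt_posD(4,5)[OF A]] .
  qed
  show "inverse ?I * ?b \<le> ?u"
  \<comment> \<open>For infinite I(G) the left side is zero, even if the Beurling density is
    infinite, by the conventions \<open>inverse top = 0\<close> and
    \<open>0 * top = 0\<close>.\<close>
  proof (cases "?I = top")
    case False
    have I0: "?I \<noteq> 0" using one_le_leptin_invariant by (metis le_zero_eq zero_neq_one)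
    have "?b / ?I \<le> ?u" unfolding ennreal_divide_le_iff[OF I0 False] by fact
    then show ?thesis by (simp add: divide_ennreal_def mult.commute)
  qed simp
qed

text \<open>Chaining the two densities through \<nu> on \<open>K \<star> A\<close> compares
  \<open>emeasure m A\<close> with \<open>emeasure m (L \<star> K \<star> A)\<close>, so I(G) at the
  compact set \<open>L \<star> K\<close> bounds the ratio of the densities.\<close>

lemma lower_leptin_le_upper_leptin:
  assumes I: "leptin_invariant mul m = 1"
  shows "lower_leptin_density mul m \<nu> \<le> upper_leptin_density mul m \<nu>"
  unfolding lower_leptin_density_def upper_leptin_density_def
proof (intro SUP_least INF_greatest)
  fix K L :: "'a set" assume K: "K \<in> cpt_sets" and L: "L \<in> cpt_sets"
  let ?l = "INF A \<in> cpt_pos_sets m. emeasure \<nu> (K \<star> A) / emeasure m A"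
  let ?u = "SUP A \<in> cpt_pos_sets m. emeasure \<nu> A / emeasure m (L \<star> A)"
  have LK: "L \<star> K \<in> cpt_sets" 
    using L K compact_setmul[of L K] setmulI by (auto simp: cpt_sets_def)
  have "?l \<le> ?u * leptin_invariant mul m"
  proof (rule le_times_leptin_invariant[OF LK])
    fix A assume A: "A \<in> cpt_pos_sets m"
    have "?l * emeasure m A \<le> emeasure \<nu> (K \<star> A)"
      unfolding ennreal_le_divide_iff[OF cpt_posD(4,5)[OF A], symmetric] by (rule INF_lower[OF A])
    also have "\<dots> \<le> ?u * emeasure m (L \<star> (K \<star> A))"
      by (rule le_upper_leptin[OF L cpt_pos_setmul[OF K A]])
    finally show "?l * emeasure m A \<le> ?u * emeasure m (L \<star> K \<star> A)"
      by (simp add: setmul_assoc)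
  qed
  then show "?l \<le> ?u" using I by simp
qed

end

end

theorem theorem4p3:
  fixes mul :: "'a::t2_space \<Rightarrow> 'a \<Rightarrow> 'a" and e :: 'a and iv :: "'a \<Rightarrow> 'a"
    and m \<nu> :: "'a measure"
  assumes "lc_group mul e iv"
    and "unimodular_haar mul m"
    and "locally_finite_measure \<nu>"
  shows "lower_beurling_density mul m \<nu> \<le> lower_leptin_density mul m \<nu>
       \<and> lower_leptin_density mul m \<nu> \<le> lower_beurling_density mul m \<nu> * leptin_invariant mul m
       \<and> inverse (leptin_invariant mul m) * upper_beurling_density mul m \<nu> \<le> upper_leptin_density mul m \<nu>
       \<and> upper_leptin_density mul m \<nu> \<le> upper_beurling_density mul m \<nu>
       \<and> (amenable_group mul m \<longrightarrow>
            lower_beurling_density mul m \<nu> = lower_leptin_density mul m \<nu>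
          \<and> lower_leptin_density mul m \<nu> \<le> upper_leptin_density mul m \<nu>
          \<and> upper_leptin_density mul m \<nu> = upper_beurling_density mul m \<nu>)"
proof -
  interpret unimodular_lc_group mul e iv m
    using assms(1,2) by unfold_locales
  note bounds = lower_beurling_le_lower_leptin[OF assms(3)] lower_leptin_le[OF assms(3)]
    upper_beurling_le[OF assms(3)] upper_leptin_le_upper_beurling[OF assms(3)]
  have "lower_beurling_density mul m \<nu> = lower_leptin_density mul m \<nu>
      \<and> lower_leptin_density mul m \<nu> \<le> upper_leptin_density mul m \<nu>
      \<and> upper_leptin_density mul m \<nu> = upper_beurling_density mul m \<nu>"
    if "amenable_group mul m"
  proof -
    have I: "leptin_invariant mul m = 1" by (rule leptin_invariant_amenable[OF that])
    show ?thesis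
      using bounds lower_leptin_le_upper_leptin[OF assms(3) I] unfolding I by (auto intro: antisym)
  qed
  then show ?thesis using bounds by blast
qed

end
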